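(* Let $\boldsymbol{\gamma}_7$ be the following real linear combination of $46$ connected simple graphs, each on the vertex set $\{1,\dots,8\}$ with $14$ edges. Each term is given by its list of edges (an entry $ij$ denotes the edge joining vertices $i$ and $j$), and the edges of each term are ordered lexicographically, i.e. in the order listed, as $I\wedge II\wedge\cdots\wedge XIV$; the coefficient follows the colon. 1. 16 17 18 23 25 28 34 38 46 48 57 58 68 78 : $1$ 2. 12 14 18 23 27 35 37 46 48 57 58 67 68 78 : $-21/8$ 3. 13 14 18 23 25 28 37 46 48 56 57 67 68 78 : $-77/4$ 4. 12 13 15 24 27 35 36 46 48 57 58 67 68 78 : $-35/8$ 5. 12 13 18 24 26 37 38 46 47 56 57 58 68 78 : $49/8$ 6. 14 17 18 23 25 26 35 37 46 48 56 58 67 78 : $77/8$ 7. 12 13 18 26 27 35 38 45 46 47 56 57 68 78 : $-105/8$ 8. 12 14 18 23 27 36 38 46 48 56 57 58 67 78 : $7/8$ 9. 12 14 15 23 27 35 36 46 48 57 58 67 68 78 : $35/8$ 10. 12 13 14 27 28 36 38 46 47 56 57 58 68 78 : $-49/8$ 11. 12 13 18 25 27 34 36 47 48 56 58 67 68 78 : $35/4$ 12. 12 13 14 25 26 36 38 45 47 57 58 67 68 78 : $-119/16$ 13. 12 13 15 24 28 36 38 47 48 56 57 67 68 78 : $49/8$ 14. 12 13 14 23 28 37 46 48 56 57 58 67 68 78 : $77/4$ 15. 12 15 17 25 26 35 36 38 45 47 48 67 68 78 : $-49/8$ 16. 13 15 18 24 26 28 37 38 46 47 56 57 68 78 : $-49/4$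 17. 13 14 18 25 26 28 36 38 47 48 56 57 67 78 : $-49/4$ 18. 12 14 18 23 28 35 37 46 48 56 57 67 68 78 : $-7$ 19. 12 14 18 23 28 36 38 46 47 56 57 58 67 78 : $-7$ 20. 12 15 16 25 27 35 36 38 46 47 48 58 67 78 : $49/8$ 21. 12 14 18 23 28 36 37 46 47 56 57 58 68 78 : $49/8$ 22. 12 13 15 26 27 35 36 45 47 48 58 67 68 78 : $-7$ 23. 12 13 18 24 28 35 38 46 47 57 58 67 68 78 : $7$ 24. 12 13 18 25 26 37 38 45 46 47 56 57 68 78 : $-7$ 25. 12 14 16 23 25 36 37 45 48 57 58 67 68 78 : $77/8$ 26. 13 16 17 24 25 26 35 37 45 48 58 67 68 78 : $-7$ 27. 14 15 17 23 26 28 37 38 46 48 56 57 68 78 : $49/4$ 28. 12 16 18 27 28 34 36 38 46 47 56 57 58 78 : $-147/8$ 29. 12 15 16 27 28 35 36 38 45 46 47 57 68 78 : $-21/8$ 30. 12 14 18 23 27 35 36 45 46 57 58 67 68 78 : $-35/8$ 31. 14 15 16 23 26 28 37 38 46 48 57 58 67 78 : $-49/4$ 32. 12 15 18 23 28 34 37 46 48 56 57 67 68 78 : $105/8$ 33. 12 14 17 23 26 37 38 46 48 56 57 58 68 78 : $-49/8$ 34. 12 16 18 25 27 35 36 37 45 46 48 57 68 78 : $49/16$ 35. 12 13 18 25 27 35 36 46 47 48 56 57 68 78 : $7$ 36. 12 14 18 25 28 34 36 38 47 57 58 67 68 78 : $-7$ 37. 12 16 18 25 27 35 36 37 45 46 48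 58 67 78 : $-77/16$ 38. 12 14 18 23 27 35 38 46 47 57 58 67 68 78 : $77/4$ 39. 12 14 15 23 27 36 38 46 48 57 58 67 68 78 : $35/2$ 40. 12 13 18 25 27 34 36 46 48 57 58 67 68 78 : $-105/8$ 41. 12 15 16 25 27 35 36 38 46 47 48 57 68 78 : $-7$ 42. 12 13 16 25 28 34 37 47 48 57 58 67 68 78 : $-147/16$ 43. 12 13 17 25 26 35 37 45 46 48 58 67 68 78 : $-77/4$ 44. 12 14 17 23 27 35 38 46 48 57 58 67 68 78 : $-49/8$ 45. 12 13 15 26 28 35 37 45 46 47 58 67 68 78 : $-7/4$ 46. 12 14 18 23 26 36 38 47 48 56 57 58 67 78 : $-7$ (Term 1 is the heptagon wheel: vertex 8 is joined to all of $1,\dots,7$, which form the cycle $1\!-\!6\!-\!4\!-\!3\!-\!2\!-\!5\!-\!7\!-\!1$.) Then $\mathrm{d}(\boldsymbol{\gamma}_7)=0$ in the non-oriented graph complex, and $\boldsymbol{\gamma}_7$ is a representative of the heptagon-wheel cohomology class, i.e. of the nontrivial $\mathrm{d}$-cohomology class in the connected graph complex in bi-degree ($8$ vertices, $14$ edges) that contains the heptagon wheel with nonzero coefficient.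
   Context: Non-oriented graph complex. Consider the real vector space spanned by finite non-oriented graphs without multiple edges and without loops (tadpoles), each equipped with a total ordering of its edge set, written as a wedge product $e_1\wedge\cdots\wedge e_m$. Two such graphs that are isomorphic are identified if the isomorphism induces an even permutation of the ordered edges, and are opposite (one equals $-1$ times the other) if it induces an odd permutation. A graph admitting an automorphism inducing an odd permutation of its edges therefore equals minus itself and is zero (a "zero graph"). Insertion: for graphs $\gamma_1,\gamma_2$, $\gamma_1\circ\gamma_2$ is the sum, over all vertices $v$ of $\gamma_2$ and over all ways of re-attaching each edge formerly incident to $v$ to some vertex of $\gamma_1$, of the graph obtained by replacing $v$ with a copy of $\gamma_1$; the edge ordering of each term is $E(\gamma_1)\wedge E(\gamma_2)$. Extended bilinearly. The bracket is $[\gamma_1,\gamma_2]=\gamma_1\circ\gamma_2-(-1)^{\#E(\gamma_1)\#E(\gamma_2)}\gamma_2\circ\gamma_1$, and the differential is $\mathrm{d}(\gamma)=[\bullet\!-\!\bullet,\gamma]$, where $\bullet\!-\!\bullet$ is the graph with two vertices and one edge; $\mathrm{d}^2=0$. A cocycle is an element of $\ker\mathrm{d}$; cohomology classes are taken modulo $\mathrm{im}\,\mathrm{d}$. The number of vertices and of edges are preserved by insertion in the obvious way, giving a bi-grading ($\#$vertices, $\#$edges). For $\ell\ge1$, the $(2\ell+1)$-wheel is the graph consisting of a cycle on $2\ell+1$ vertices together with an extra (axis) vertex joined to each of them. *)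

theory Defs
  imports Complex_Main "HOL-Combinatorics.Permutations"
begin

section \<open>Graphs with ordered edge sets\<close>

text \<open>A graph is a pair (n, es): vertex set {0..<n}; es is the list of edges in
their chosen order e_1 wedge ... wedge e_m, each edge an unordered pair.\<close>

type_synonym graph = "nat \<times> nat set list"

definition wf_graph :: "graph \<Rightarrow> bool" where
  "wf_graph G \<longleftrightarrow> distinct (snd G) \<and>
     (\<forall>e\<in>set (snd G). \<exists>a b. e = {a, b} \<and> a \<noteq> b \<and> a < fst G \<and> b < fst G)"

definition connected_graph :: "graph \<Rightarrow> bool" where
  "connected_graph G \<longleftrightarrow> fst G \<ge> 1 \<and>
     (\<forall>i<fst G. \<forall>j<fst G. (i, j) \<in> {(a, b). {a, b} \<in> set (snd G)}\<^sup>*)"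

text \<open>An isomorphism G -> G' given by a vertex bijection pi; the induced permutation
p of edge positions sends position i of G to position p i of G'; s is its sign.\<close>

definition iso_sign :: "graph \<Rightarrow> graph \<Rightarrow> int \<Rightarrow> bool" where
  "iso_sign G G' s \<longleftrightarrow> fst G = fst G' \<and> length (snd G) = length (snd G') \<and>
     (\<exists>\<pi> p. \<pi> permutes {0..<fst G} \<and> p permutes {0..<length (snd G)} \<and>
        (\<forall>i<length (snd G). snd G' ! (p i) = \<pi> ` (snd G ! i)) \<and> s = sign p)"

definition isomorphic :: "graph \<Rightarrow> graph \<Rightarrow> bool" where
  "isomorphic G G' \<longleftrightarrow> (\<exists>s. iso_sign G G' s)"

section \<open>Chains: finitely supported real combinations of graphs\<close>

type_synonym chain = "graph \<Rightarrow> real"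

definition ind :: "graph \<Rightarrow> chain" where
  "ind G = (\<lambda>H. if H = G then 1 else 0)"

definition supp :: "chain \<Rightarrow> graph set" where
  "supp c = {G. c G \<noteq> 0}"

definition is_chain :: "chain \<Rightarrow> bool" where
  "is_chain c \<longleftrightarrow> finite (supp c) \<and> (\<forall>G\<in>supp c. wf_graph G)"

definition is_conn_chain :: "chain \<Rightarrow> bool" where
  "is_conn_chain c \<longleftrightarrow> is_chain c \<and> (\<forall>G\<in>supp c. connected_graph G)"

text \<open>The subspace of relations: the span of G - s G' for isomorphisms G -> G' of sign s.
Two chains are equal in the graph complex iff their difference lies in rel.\<close>

inductive_set rel :: "chain set" where
  rel_zero: "(\<lambda>_. 0) \<in> rel"
| rel_gen: "wf_graph G \<Longrightarrow> wf_graph G' \<Longrightarrow> iso_sign G G' s \<Longrightarrow>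
             (\<lambda>H. ind G H - of_int s * ind G' H) \<in> rel"
| rel_add: "a \<in> rel \<Longrightarrow> b \<in> rel \<Longrightarrow> (\<lambda>H. a H + b H) \<in> rel"
| rel_smult: "a \<in> rel \<Longrightarrow> (\<lambda>H. r * a H) \<in> rel"

section \<open>Insertion and differential\<close>

text \<open>Relabelling of the vertices u /= v of G2 after replacing v by a copy of G1
(G1 keeps labels 0..<n1).\<close>

definition shift_vertex :: "nat \<Rightarrow> nat \<Rightarrow> nat \<Rightarrow> nat" where
  "shift_vertex n1 v u = n1 + (if u < v then u else u - 1)"

text \<open>Attachment data: for every position k of an edge of G2 incident to v, the vertex
a k of G1 to which that edge is re-attached.\<close>

definition attachments :: "nat \<Rightarrow> graph \<Rightarrow> nat \<Rightarrow> (nat \<Rightarrow> nat) set" where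
  "attachments n1 G2 v = {a. \<forall>k. (k < length (snd G2) \<and> v \<in> snd G2 ! k \<longrightarrow> a k < n1) \<and>
       (\<not> (k < length (snd G2) \<and> v \<in> snd G2 ! k) \<longrightarrow> a k = 0)}"

definition insert_graph :: "graph \<Rightarrow> graph \<Rightarrow> nat \<Rightarrow> (nat \<Rightarrow> nat) \<Rightarrow> graph" where
  "insert_graph G1 G2 v a =
     (fst G1 + fst G2 - 1,
      snd G1 @ map (\<lambda>k. let e = snd G2 ! k in
                         if v \<in> e then {shift_vertex (fst G1) v (the_elem (e - {v})), a k}
                         else shift_vertex (fst G1) v ` e)
                   [0..<length (snd G2)])"

definition ins :: "graph \<Rightarrow> graph \<Rightarrow> chain" where
  "ins G1 G2 = (\<lambda>H. \<Sum>v<fst G2. \<Sum>a\<in>attachments (fst G1) G2 v. ind (insert_graph G1 G2 v a) H)"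

definition edge_graph :: graph where
  "edge_graph = (2, [{0, 1}])"

text \<open>d(c) = [edge, c] = sum_G c(G) (edge o G - (-1)^(#E(G)) G o edge).\<close>

definition dgc :: "chain \<Rightarrow> chain" where
  "dgc c = (\<lambda>H. \<Sum>G\<in>supp c. c G *
      (ins edge_graph G H - (-1) ^ length (snd G) * ins G edge_graph H))"

section \<open>The heptagon-wheel cocycle gamma_7\<close>

text \<open>An entry ij (as the decimal number 10 i + j) denotes the edge {i, j} on vertices
1..8; we relabel vertex i as i - 1.\<close>

definition dec_edge :: "nat \<Rightarrow> nat set" where
  "dec_edge k = {k div 10 - 1, k mod 10 - 1}"

definition gr8 :: "nat list \<Rightarrow> graph" where
  "gr8 es = (8, map dec_edge es)"

definition gamma7_terms :: "(nat list \<times> real) list" where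
  "gamma7_terms = [
   ([16,17,18,23,25,28,34,38,46,48,57,58,68,78], 1),
   ([12,14,18,23,27,35,37,46,48,57,58,67,68,78], -21/8),
   ([13,14,18,23,25,28,37,46,48,56,57,67,68,78], -77/4),
   ([12,13,15,24,27,35,36,46,48,57,58,67,68,78], -35/8),
   ([12,13,18,24,26,37,38,46,47,56,57,58,68,78], 49/8),
   ([14,17,18,23,25,26,35,37,46,48,56,58,67,78], 77/8),
   ([12,13,18,26,27,35,38,45,46,47,56,57,68,78], -105/8),
   ([12,14,18,23,27,36,38,46,48,56,57,58,67,78], 7/8),
   ([12,14,15,23,27,35,36,46,48,57,58,67,68,78], 35/8),
   ([12,13,14,27,28,36,38,46,47,56,57,58,68,78], -49/8),
   ([12,13,18,25,27,34,36,47,48,56,58,67,68,78], 35/4),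
   ([12,13,14,25,26,36,38,45,47,57,58,67,68,78], -119/16),
   ([12,13,15,24,28,36,38,47,48,56,57,67,68,78], 49/8),
   ([12,13,14,23,28,37,46,48,56,57,58,67,68,78], 77/4),
   ([12,15,17,25,26,35,36,38,45,47,48,67,68,78], -49/8),
   ([13,15,18,24,26,28,37,38,46,47,56,57,68,78], -49/4),
   ([13,14,18,25,26,28,36,38,47,48,56,57,67,78], -49/4),
   ([12,14,18,23,28,35,37,46,48,56,57,67,68,78], -7),
   ([12,14,18,23,28,36,38,46,47,56,57,58,67,78], -7),
   ([12,15,16,25,27,35,36,38,46,47,48,58,67,78], 49/8),
   ([12,14,18,23,28,36,37,46,47,56,57,58,68,78], 49/8),
   ([12,13,15,26,27,35,36,45,47,48,58,67,68,78], -7),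
   ([12,13,18,24,28,35,38,46,47,57,58,67,68,78], 7),
   ([12,13,18,25,26,37,38,45,46,47,56,57,68,78], -7),
   ([12,14,16,23,25,36,37,45,48,57,58,67,68,78], 77/8),
   ([13,16,17,24,25,26,35,37,45,48,58,67,68,78], -7),
   ([14,15,17,23,26,28,37,38,46,48,56,57,68,78], 49/4),
   ([12,16,18,27,28,34,36,38,46,47,56,57,58,78], -147/8),
   ([12,15,16,27,28,35,36,38,45,46,47,57,68,78], -21/8),
   ([12,14,18,23,27,35,36,45,46,57,58,67,68,78], -35/8),
   ([14,15,16,23,26,28,37,38,46,48,57,58,67,78], -49/4),
   ([12,15,18,23,28,34,37,46,48,56,57,67,68,78], 105/8),
   ([12,14,17,23,26,37,38,46,48,56,57,58,68,78], -49/8),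
   ([12,16,18,25,27,35,36,37,45,46,48,57,68,78], 49/16),
   ([12,13,18,25,27,35,36,46,47,48,56,57,68,78], 7),
   ([12,14,18,25,28,34,36,38,47,57,58,67,68,78], -7),
   ([12,16,18,25,27,35,36,37,45,46,48,58,67,78], -77/16),
   ([12,14,18,23,27,35,38,46,47,57,58,67,68,78], 77/4),
   ([12,14,15,23,27,36,38,46,48,57,58,67,68,78], 35/2),
   ([12,13,18,25,27,34,36,46,48,57,58,67,68,78], -105/8),
   ([12,15,16,25,27,35,36,38,46,47,48,57,68,78], -7),
   ([12,13,16,25,28,34,37,47,48,57,58,67,68,78], -147/16),
   ([12,13,17,25,26,35,37,45,46,48,58,67,68,78], -77/4),
   ([12,14,17,23,27,35,38,46,48,57,58,67,68,78], -49/8),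
   ([12,13,15,26,28,35,37,45,46,47,58,67,68,78], -7/4),
   ([12,14,18,23,26,36,38,47,48,56,57,58,67,78], -7)]"

definition gamma7 :: chain where
  "gamma7 = (\<lambda>H. \<Sum>(es, c)\<leftarrow>gamma7_terms. c * ind (gr8 es) H)"

text \<open>The heptagon wheel (term 1): axis vertex 8, rim cycle 1-6-4-3-2-5-7-1.\<close>

definition heptagon_wheel :: graph where
  "heptagon_wheel = gr8 [16,17,18,23,25,28,34,38,46,48,57,58,68,78]"

end

theory Submission
  imports Defs
begin

text \<open>Modulo relations, the differential of a graph without vertices of valency below 3 is twice
  the sum of its splittings into two vertices that both keep at least two of the old edges: leaves
  cancel against the second term of the bracket, and the two subdivisions of each edge cancel each
  other. For \<open>gamma7\<close> this leaves 740 graphs on nine vertices, for which explicit relabellings to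
  canonical forms show that the coefficients cancel.

  For the nontriviality, count the copies of the heptagon wheel with sign. This is well defined on
  the graph complex because all automorphisms of the wheel are even on edges, and it takes the
  value 1 on \<open>gamma7\<close>. It vanishes on every coboundary: every edge of the wheel lies in a
  triangle, whereas the edge created by a vertex splitting or by attaching a leaf never does.\<close>

section \<open>Equality modulo relations\<close>

text \<open>Searching for canonical forms of nine-vertex graphs inside the logic would be expensive,
  so the relabellings are supplied as data that need not be trusted: any permutation of the vertices
  preserves the class of a graph once the sign of the resulting edge reordering is recorded. A poor
  choice could only leave uncancelled terms, never produce a false cancellation. Likewise an odd
  automorphism is not searched for but exhibited by two relabellings with the same result and
  opposite signs.

  The signed count is a linear functional that annihilates \<open>rel\<close>. Its vanishing on
  coboundaries is checked graph by graph and involves no cancellation between terms. Its value on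
  \<open>gamma7\<close> comes from the wheel alone, since no other term has a vertex joined to all
  the others. One functional therefore excludes both a primitive of \<open>gamma7\<close> and an
  equal chain in the graph complex that contains no copy of the wheel.\<close>

definition eqv :: "chain \<Rightarrow> chain \<Rightarrow> bool" where
  "eqv a b \<longleftrightarrow> (\<lambda>H. a H - b H) \<in> rel"

lemma eqv_refl [simp]: "eqv a a"
  using rel_zero by (simp add: eqv_def)

lemma eqv_smult: "eqv a b \<Longrightarrow> eqv (\<lambda>H. r * a H) (\<lambda>H. r * b H)"
  using rel_smult[of "\<lambda>H. a H - b H" r] by (simp add: eqv_def right_diff_distrib)

lemma eqv_add: "eqv a b \<Longrightarrow> eqv a' b' \<Longrightarrow> eqv (\<lambda>H. a H + a' H) (\<lambda>H. b H + b' H)"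
  using rel_add[of "\<lambda>H. a H - b H" "\<lambda>H. a' H - b' H"] by (simp add: eqv_def algebra_simps)

lemma eqv_diff: "eqv a b \<Longrightarrow> eqv a' b' \<Longrightarrow> eqv (\<lambda>H. a H - a' H) (\<lambda>H. b H - b' H)"
  using eqv_add[OF _ eqv_smult[of a' b' "-1"], of a b] by simp

lemma eqv_sym: "eqv a b \<Longrightarrow> eqv b a"
  using rel_smult[of "\<lambda>H. a H - b H" "-1"] by (simp add: eqv_def)

lemma eqv_trans [trans]: "eqv a b \<Longrightarrow> eqv b c \<Longrightarrow> eqv a c"
  using rel_add[of "\<lambda>H. a H - b H" "\<lambda>H. b H - c H"] by (simp add: eqv_def)

lemma eqv_sum: "(\<And>i. i \<in> I \<Longrightarrow> eqv (f i) (g i)) \<Longrightarrow> eqv (\<lambda>H. \<Sum>i\<in>I. f i H) (\<lambda>H. \<Sum>i\<in>I. g i H)"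
  by (induction I rule: infinite_finite_induct) (auto intro!: eqv_add)

lemma eqv_sum_list:
  "(\<And>x. x \<in> set xs \<Longrightarrow> eqv (f x) (g x)) \<Longrightarrow> eqv (\<lambda>H. \<Sum>x\<leftarrow>xs. f x H) (\<lambda>H. \<Sum>x\<leftarrow>xs. g x H)"
  by (induction xs) (auto intro!: eqv_add)

lemma eqv_ind_iso:
  assumes "wf_graph G" "wf_graph G'" "iso_sign G G' s"
  shows "eqv (ind G) (\<lambda>H. of_int s * ind G' H)"
  using rel_gen[OF assms] by (simp add: eqv_def)

section \<open>Signed isomorphisms: relabelled vertices and reordered edges\<close>

lemma iso_signI:
  assumes "\<pi> permutes {0..<n}" "p permutes {0..<length es}" "length es' = length es"
    "\<And>i. i < length es \<Longrightarrow> es' ! p i = \<pi> ` (es ! i)"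
  shows "iso_sign (n, es) (n, es') (sign p)"
  using assms unfolding iso_sign_def by auto

lemma wf_graph_edgeE:
  assumes "wf_graph (n, es)" "e \<in> set es"
  obtains a b where "e = {a, b}" "a \<noteq> b" "a < n" "b < n"
  using assms unfolding wf_graph_def by fastforce

lemma edge_exI:
  "e = {a, b} \<Longrightarrow> a \<noteq> b \<Longrightarrow> a < n \<Longrightarrow> b < n \<Longrightarrow> \<exists>a b. e = {a, b} \<and> a \<noteq> b \<and> a < n \<and> b < n"
  for n :: nat
  by blast

lemma wf_graph_relabel:
  assumes wf: "wf_graph (n, es)" and \<pi>: "\<pi> permutes {0..<n}"
  shows "wf_graph (n, map ((`) \<pi>) es)"
proof -
  have inj: "inj \<pi>" using \<pi> by (rule permutes_inj)
  have "distinct (map ((`) \<pi>) es)"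
    using wf inj by (auto simp: wf_graph_def distinct_map inj_on_def inj_image_eq_iff)
  moreover have "\<exists>a b. \<pi> ` e = {a, b} \<and> a \<noteq> b \<and> a < n \<and> b < n" if "e \<in> set es" for e
  proof -
    obtain a b where "e = {a, b}" "a \<noteq> b" "a < n" "b < n"
      using wf \<open>e \<in> set es\<close> by (rule wf_graph_edgeE)
    then show ?thesis
      using permutes_in_image[OF \<pi>] inj_eq[OF inj]
      by (intro edge_exI[of _ "\<pi> a" "\<pi> b"]) simp_all
  qed
  ultimately show ?thesis by (auto simp: wf_graph_def)
qed

text \<open>Applying a vertex permutation edge by edge keeps every edge in its position, so the
  induced edge permutation is the identity and no sign appears.\<close>

lemma eqv_relabel:
  assumes "wf_graph (n, es)" and \<pi>: "\<pi> permutes {0..<n}"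
  shows "eqv (ind (n, es)) (ind (n, map ((`) \<pi>) es))"
proof -
  have "iso_sign (n, es) (n, map ((`) \<pi>) es) 1"
    using iso_signI[OF \<pi>, of id es "map ((`) \<pi>) es"] by (simp add: permutes_id)
  from eqv_ind_iso[OF assms(1) wf_graph_relabel[OF assms] this] show ?thesis by simp
qed

lemma wf_graph_mset: "mset xs = mset ys \<Longrightarrow> wf_graph (n, xs) = wf_graph (n, ys)"
  using mset_eq_imp_distinct_iff[of xs ys] mset_eq_setD[of xs ys] by (auto simp: wf_graph_def)

text \<open>The vertices stay fixed and only two positions are exchanged, so the sign is that of a
  transposition. The edge reorderings in the differential all reduce to this case.\<close>

lemma eqv_transpose_edges:
  assumes wf: "wf_graph (n, es)" and ij: "i < length es" "j < length es" "i \<noteq> j"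
  shows "eqv (ind (n, es)) (\<lambda>H. - ind (n, es[i := es ! j, j := es ! i]) H)"
proof -
  have "iso_sign (n, es) (n, es[i := es ! j, j := es ! i]) (- 1)"
    using ij iso_signI[OF permutes_id permutes_swap_id, of i es j "es[i := es ! j, j := es ! i]" n]
    by (auto simp: sign_swap_id nth_list_update transpose_def)
  moreover have "wf_graph (n, es[i := es ! j, j := es ! i])"
    using wf wf_graph_mset[OF mset_swap[OF ij(2,1)], of n] by (simp add: list_update_swap[OF ij(3)])
  ultimately show ?thesis using eqv_ind_iso[OF wf] by fastforce
qed

lemma eqv_swap:
  assumes wf: "wf_graph (n, xs @ a # b # ys)"
  shows "eqv (ind (n, xs @ a # b # ys)) (\<lambda>H. - ind (n, xs @ b # a # ys) H)"
  using eqv_transpose_edges[OF wf, of "length xs" "Suc (length xs)"]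
  by (simp add: nth_append list_update_append)

text \<open>The edge \<open>e\<close> passes one edge of \<open>es\<close> at a time. With
  \<open>es\<close> the whole edge list, the resulting power of -1 is the sign in the second term of
  the bracket.\<close>

lemma eqv_rotate:
  assumes "wf_graph (n, xs @ e # es)"
  shows "eqv (ind (n, xs @ e # es)) (\<lambda>H. (-1) ^ length es * ind (n, xs @ es @ [e]) H)"
  using assms
proof (induction es arbitrary: xs)
  case Nil
  then show ?case by simp
next
  case (Cons a es)
  have "eqv (ind (n, xs @ e # a # es)) (\<lambda>H. - 1 * ind (n, xs @ a # e # es) H)"
    using eqv_swap[OF Cons.prems] by simp
  also have "wf_graph (n, (xs @ [a]) @ e # es)"
    using Cons.prems wf_graph_mset[of "xs @ a # e # es" "xs @ e # a # es" n] by simp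
  then have "eqv (\<lambda>H. - 1 * ind (n, xs @ a # e # es) H)
      (\<lambda>H. - 1 * ((-1) ^ length es * ind (n, (xs @ [a]) @ es @ [e]) H))"
    using eqv_smult[OF Cons.IH[of "xs @ [a]"], of "- 1"] by simp
  finally show ?case by simp
qed

section \<open>Vertex splittings\<close>

text \<open>Positions rather than edges, because \<open>attachments\<close> is indexed by position
  as well.\<close>

definition incident :: "nat set list \<Rightarrow> nat \<Rightarrow> nat set" where
  "incident es v = {k. k < length es \<and> v \<in> es ! k}"

text \<open>Insertion of the edge graph at \<open>v\<close>, in labels that disturb \<open>G\<close>
  as little as possible: \<open>v\<close> stays one end of the new edge, the fresh label
  \<open>fst G\<close> is the other end, and the edges at the positions in \<open>S\<close> move to
  it. The new edge comes first, as in \<open>insert_graph\<close>.\<close>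

definition split_graph :: "graph \<Rightarrow> nat \<Rightarrow> nat set \<Rightarrow> graph" where
  "split_graph G v S = (Suc (fst G), {v, fst G} #
     map (\<lambda>k. if k \<in> S then insert (fst G) (snd G ! k - {v}) else snd G ! k) [0..<length (snd G)])"

lemma split_graph_Pair:
  "split_graph (n, es) v S =
    (Suc n, {v, n} # map (\<lambda>k. if k \<in> S then insert n (es ! k - {v}) else es ! k) [0..<length es])"
  by (simp add: split_graph_def)

lemma finite_incident [simp]: "finite (incident es v)"
  by (simp add: incident_def)

lemma incident_edgeE:
  assumes "wf_graph (n, es)" "k \<in> incident es v"
  obtains u where "es ! k = {u, v}" "u \<noteq> v" "u < n"
proof -
  have "es ! k \<in> set es" and v: "v \<in> es ! k"
    using assms(2) by (auto simp: incident_def)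
  then obtain a b where ab: "es ! k = {a, b}" "a \<noteq> b" "a < n" "b < n"
    using wf_graph_edgeE[OF assms(1)] by blast
  show ?thesis
  proof (cases "v = a")
    case True
    then show ?thesis using ab by (intro that[of b]) auto
  next
    case False
    then show ?thesis using ab v by (intro that[of a]) auto
  qed
qed

lemma edge_less: "wf_graph (n, es) \<Longrightarrow> k < length es \<Longrightarrow> x \<in> es ! k \<Longrightarrow> x < n"
  by (metis wf_graph_edgeE nth_mem insertE singletonD)

lemma wf_split_graph:
  assumes wf: "wf_graph (n, es)" and v: "v < n" and S: "S \<subseteq> incident es v"
  shows "wf_graph (split_graph (n, es) v S)"
proof -
  let ?m = "\<lambda>k. if k \<in> S then insert n (es ! k - {v}) else es ! k"
  \<comment> \<open>Contracting the new edge sends \<open>n\<close> back to \<open>v\<close> and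
    recovers \<open>es\<close>; distinctness of the modified edges is pulled back along this
    contraction.\<close>
  let ?c = "\<lambda>x. if x = n then v else x"
  have edge: "\<exists>a b. ?m k = {a, b} \<and> a \<noteq> b \<and> a < Suc n \<and> b < Suc n" and merge: "?c ` ?m k = es ! k"
    if k: "k < length es" for k
  proof -
    obtain a b where ab: "es ! k = {a, b}" "a \<noteq> b" "a < n" "b < n"
      using wf_graph_edgeE[OF wf nth_mem[OF k]] .
    show "\<exists>a b. ?m k = {a, b} \<and> a \<noteq> b \<and> a < Suc n \<and> b < Suc n"
    proof (cases "k \<in> S")
      case True
      then obtain u where "es ! k = {u, v}" "u \<noteq> v" "u < n"
        using incident_edgeE[OF wf] S by blast
      then show ?thesis using True
        by (intro edge_exI[of _ u n]) auto
    next
      case False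
      then show ?thesis using ab
        by (intro edge_exI[of _ a b]) auto
    qed
    show "?c ` ?m k = es ! k"
    proof (cases "k \<in> S")
      case True
      then obtain u where "es ! k = {u, v}" "u \<noteq> v" "u < n"
        using incident_edgeE[OF wf] S by blast
      then show ?thesis using True by auto
    next
      case False
      then show ?thesis using ab by auto
    qed
  qed
  have "map ((`) ?c) (map ?m [0..<length es]) = es"
    using merge by (intro nth_equalityI) auto
  moreover have "distinct es" using wf by (simp add: wf_graph_def)
  ultimately have "distinct (map ((`) ?c) (map ?m [0..<length es]))" by (simp only:)
  then have dist: "distinct (map ?m [0..<length es])" unfolding distinct_map[of "(`) ?c"] by (rule conjunct1)
  \<comment> \<open>A second copy of the new edge would contract to a loop at
    \<open>v\<close>.\<close>
  have ne: "?m k \<noteq> {v, n}" if k: "k < length es" for k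
  proof
    assume "?m k = {v, n}"
    then have "es ! k = {v}" using merge[OF k] v by auto
    moreover obtain a b where "es ! k = {a, b}" "a \<noteq> b"
      using wf_graph_edgeE[OF wf nth_mem[OF k]] .
    ultimately show False by (auto simp: doubleton_eq_iff)
  qed
  have "{v, n} \<notin> set (map ?m [0..<length es])"
  proof
    assume "{v, n} \<in> set (map ?m [0..<length es])"
    then obtain k where "{v, n} = ?m k" "k \<in> set [0..<length es]"
      unfolding set_map by (rule imageE)
    then show False using ne[of k] by simp
  qed
  moreover have "\<exists>a b. {v, n} = {a, b} \<and> a \<noteq> b \<and> a < Suc n \<and> b < Suc n"
    using v by (intro edge_exI[of _ v n]) simp_all
  moreover have "\<forall>e\<in>set (map ?m [0..<length es]). \<exists>a b. e = {a, b} \<and> a \<noteq> b \<and> a < Suc n \<and> b < Suc n"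
  proof
    fix e assume "e \<in> set (map ?m [0..<length es])"
    then obtain k where "e = ?m k" "k \<in> set [0..<length es]"
      unfolding set_map by (rule imageE)
    then show "\<exists>a b. e = {a, b} \<and> a \<noteq> b \<and> a < Suc n \<and> b < Suc n" using edge[of k] by simp
  qed
  ultimately show ?thesis
    using dist unfolding wf_graph_def split_graph_Pair fst_conv snd_conv distinct.simps list.set ball_simps
    by blast
qed

text \<open>Exchanging the labels \<open>v\<close> and \<open>n\<close> flips the new edge and swaps
  the roles of its ends, while every edge keeps its position. Complementary sets thus agree with
  sign plus, which is where the factor 2 in the differential comes from.\<close>

lemma eqv_split_compl:
  assumes wf: "wf_graph (n, es)" and v: "v < n" and S: "S \<subseteq> incident es v"
  shows "eqv (ind (split_graph (n, es) v S)) (ind (split_graph (n, es) v (incident es v - S)))"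
proof -
  let ?\<pi> = "transpose v n"
  let ?m = "\<lambda>S k. if k \<in> S then insert n (es ! k - {v}) else es ! k"
  have edge: "?\<pi> ` ?m S k = ?m (incident es v - S) k" if k: "k < length es" for k
  proof (cases "k \<in> incident es v")
    case True
    then obtain u where "es ! k = {u, v}" "u \<noteq> v" "u < n"
      using incident_edgeE[OF wf] by blast
    then show ?thesis using True by (auto simp: transpose_def)
  next
    case False
    then have "v \<notin> es ! k" "k \<notin> S" using k S by (auto simp: incident_def)
    moreover have "n \<notin> es ! k" using edge_less[OF wf k] by blast
    ultimately show ?thesis using False by (auto simp: transpose_def image_iff)
  qed
  have "?\<pi> ` {v, n} = {v, n}" by (auto simp: transpose_def)
  then have eq: "split_graph (n, es) v (incident es v - S) =
      (Suc n, map ((`) ?\<pi>) ({v, n} # map (?m S) [0..<length es]))"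
    using edge by (simp add: split_graph_Pair del: image_insert)
  have "?\<pi> permutes {0..<Suc n}" using v by (intro permutes_swap_id) auto
  from eqv_relabel[OF wf_split_graph[OF assms, unfolded split_graph_Pair] this]
  show ?thesis unfolding eq unfolding split_graph_Pair .
qed

lemma eqv_split_insert_graph:
  assumes wf: "wf_graph (n, es)" and v: "v < n" and S: "S \<subseteq> incident es v"
  shows "eqv (ind (split_graph (n, es) v S))
    (ind (insert_graph edge_graph (n, es) v (\<lambda>k. if k \<in> S then 1 else 0)))"
proof -
  \<comment> \<open>\<open>insert_graph\<close> labels the ends of the inserted edge 0 and 1 and
    shifts the other vertices by two, closing the gap at \<open>v\<close>. The map
    \<open>\<rho>\<close> carries the labels of \<open>split_graph\<close> to these and fixes
    everything beyond \<open>n\<close>.\<close>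
  define \<rho> where "\<rho> = (\<lambda>x. if x = v then 0 else if x = n then 1 else if x < n then shift_vertex 2 v x else x)"
  have "inj_on \<rho> {0..<Suc n}"
    using v by (auto simp: inj_on_def \<rho>_def shift_vertex_def split: if_splits)
  moreover have "\<rho> ` {0..<Suc n} \<subseteq> {0..<Suc n}"
    using v by (auto simp: \<rho>_def shift_vertex_def)
  ultimately have "bij_betw \<rho> {0..<Suc n} {0..<Suc n}"
    by (simp add: bij_betw_def endo_inj_surj)
  then have perm: "\<rho> permutes {0..<Suc n}"
    using v by (rule_tac bij_imp_permutes) (auto simp: \<rho>_def)
  have edge: "\<rho> ` (if k \<in> S then insert n (es ! k - {v}) else es ! k) =
      (if v \<in> es ! k then {shift_vertex 2 v (the_elem (es ! k - {v})), if k \<in> S then 1 else 0}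
       else shift_vertex 2 v ` (es ! k))"
    if k: "k < length es" for k
  proof (cases "k \<in> incident es v")
    case True
    then obtain u where u: "es ! k = {u, v}" "u \<noteq> v" "u < n"
      using incident_edgeE[OF wf] by blast
    then have "es ! k - {v} = {u}" by auto
    then show ?thesis using u v by (auto simp: \<rho>_def)
  next
    case False
    then have "v \<notin> es ! k" "k \<notin> S" using k S by (auto simp: incident_def)
    then show ?thesis using edge_less[OF wf k] by (auto simp: \<rho>_def intro!: image_cong)
  qed
  have "\<rho> ` {v, n} = {0, 1}" using v by (auto simp: \<rho>_def)
  then have eq: "insert_graph edge_graph (n, es) v (\<lambda>k. if k \<in> S then 1 else 0) =
      (Suc n, map ((`) \<rho>) ({v, n} #
        map (\<lambda>k. if k \<in> S then insert n (es ! k - {v}) else es ! k) [0..<length es]))"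
    using edge by (simp add: insert_graph_def edge_graph_def Let_def del: image_insert)
  from eqv_relabel[OF wf_split_graph[OF assms, unfolded split_graph_Pair] perm]
  show ?thesis unfolding eq unfolding split_graph_Pair .
qed

section \<open>The two terms of the bracket with the edge graph\<close>

lemma eqv_ins_edge:
  assumes wf: "wf_graph (n, es)"
  shows "eqv (ins edge_graph (n, es))
    (\<lambda>H. \<Sum>v<n. \<Sum>S\<in>Pow (incident es v). ind (split_graph (n, es) v S) H)"
proof -
  \<comment> \<open>An attachment to two vertices is the indicator function of the positions sent to
    vertex 1. The default value 0 in \<open>attachments\<close> keeps this set inside
    \<open>incident es v\<close>.\<close>
  have bij: "bij_betw (\<lambda>S k. if k \<in> S then 1 else 0) (Pow (incident es v)) (attachments 2 (n, es) v)" for v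
  proof (intro bij_betw_byWitness[where f' = "\<lambda>a. {k. a k = 1}"])
    show "\<forall>a\<in>attachments 2 (n, es) v. (\<lambda>k. if k \<in> {k. a k = 1} then 1 else 0) = a"
    proof (intro ballI ext)
      fix a k assume "a \<in> attachments 2 (n, es) v"
      then have "a k < 2" by (cases "k < length es \<and> v \<in> es ! k") (simp_all add: attachments_def)
      then show "(if k \<in> {k. a k = 1} then 1 else 0) = a k" by (auto dest: less_2_cases)
    qed
    show "(\<lambda>a. {k. a k = 1}) ` attachments 2 (n, es) v \<subseteq> Pow (incident es v)"
      unfolding attachments_def incident_def by (auto simp del: One_nat_def) (metis zero_neq_one)+
  qed (auto simp: attachments_def incident_def)
  have "ins edge_graph (n, es) = (\<lambda>H. \<Sum>v<n. \<Sum>S\<in>Pow (incident es v).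
      ind (insert_graph edge_graph (n, es) v (\<lambda>k. if k \<in> S then 1 else 0)) H)"
  proof
    fix H
    have "ins edge_graph (n, es) H =
        (\<Sum>v<n. \<Sum>a\<in>attachments 2 (n, es) v. ind (insert_graph edge_graph (n, es) v a) H)"
      by (simp add: ins_def) (simp add: edge_graph_def)
    also have "\<dots> = (\<Sum>v<n. \<Sum>S\<in>Pow (incident es v).
      ind (insert_graph edge_graph (n, es) v (\<lambda>k. if k \<in> S then 1 else 0)) H)"
      by (intro sum.cong refl sum.reindex_bij_betw[OF bij, symmetric])
    finally show "ins edge_graph (n, es) H = \<dots>" .
  qed
  then show ?thesis
    by (auto intro!: eqv_sum eqv_sym[OF eqv_split_insert_graph[OF wf]])
qed

text \<open>Each vertex of the edge graph lies on its one edge, so an attachment is just the choice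
  of the vertex \<open>u\<close> that receives the leaf. Replacing either vertex gives the same sum,
  hence the factor 2; the surviving vertex gets the label \<open>n\<close> in both cases.\<close>

lemma ins_into_edge:
  "ins (n, es) edge_graph = (\<lambda>H. 2 * (\<Sum>u<n. ind (Suc n, es @ [{u, n}]) H))"
proof -
  have bij: "bij_betw (\<lambda>u k. if k = 0 then u else (0::nat)) {..<n} (attachments n edge_graph v)" if v: "v < 2" for v
  proof -
    have "k < length (snd edge_graph) \<and> v \<in> snd edge_graph ! k \<longleftrightarrow> k = 0" for k
      using v by (cases k) (auto simp: edge_graph_def)
    then have "attachments n edge_graph v = {a. \<forall>k. (k = 0 \<longrightarrow> a k < n) \<and> (k \<noteq> 0 \<longrightarrow> a k = 0)}"
      unfolding attachments_def by simp
    then have "attachments n edge_graph v = (\<lambda>u k. if k = 0 then u else 0) ` {..<n}"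
      by (auto simp: fun_eq_iff image_iff)
    then show ?thesis by (auto simp: bij_betw_def inj_on_def fun_eq_iff)
  qed
  have "insert_graph (n, es) edge_graph v (\<lambda>k. if k = 0 then u else 0) = (Suc n, es @ [{u, n}])"
    if "v < 2" for v u
  proof -
    have "the_elem ({0, 1} - {v}) = 1 - v"
      using less_2_cases[OF that] by (auto simp: insert_Diff_if)
    then show ?thesis
      using less_2_cases[OF that]
      by (elim disjE) (simp_all add: insert_graph_def edge_graph_def shift_vertex_def insert_commute)
  qed
  then have "(\<Sum>a\<in>attachments n edge_graph v. ind (insert_graph (n, es) edge_graph v a) H) =
      (\<Sum>u<n. ind (Suc n, es @ [{u, n}]) H)" if "v < 2" for v H
    using that sum.reindex_bij_betw[OF bij[OF that], of "\<lambda>a. ind (insert_graph (n, es) edge_graph v a) H"]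
    by simp
  then show ?thesis
    by (simp add: ins_def fun_eq_iff numeral_2_eq_2 edge_graph_def)
qed

definition d_graph :: "graph \<Rightarrow> chain" where
  "d_graph G = (\<lambda>H. ins edge_graph G H - (-1) ^ length (snd G) * ins G edge_graph H)"

text \<open>Excluding one fixed incident position picks one set from each complementary pair. The
  cardinality bounds leave two old edges at either end of the new one.\<close>

definition half_splits :: "nat set list \<Rightarrow> nat \<Rightarrow> nat set set" where
  "half_splits es v = {S. S \<subseteq> incident es v - {Min (incident es v)} \<and>
     2 \<le> card S \<and> card S + 2 \<le> card (incident es v)}"

text \<open>The set \<open>P\<close> of the proof consists of the empty set, the singletons and the
  larger sets avoiding \<open>m\<close>, and meets each complementary pair exactly once. The bound
  of three elements matters: in a two-element set the singletons would be paired with each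
  other.\<close>

lemma eqv_sum_Pow:
  fixes f :: "nat set \<Rightarrow> chain"
  assumes I: "finite I" "3 \<le> card I" and m: "m \<in> I"
    and compl: "\<And>S. S \<subseteq> I \<Longrightarrow> eqv (f S) (f (I - S))"
  shows "eqv (\<lambda>H. \<Sum>S\<in>Pow I. f S H)
    (\<lambda>H. 2 * (f {} H + (\<Sum>k\<in>I. f {k} H) +
      (\<Sum>S | S \<subseteq> I - {m} \<and> 2 \<le> card S \<and> card S + 2 \<le> card I. f S H)))"
proof -
  define F where "F = {S. S \<subseteq> I - {m} \<and> 2 \<le> card S \<and> card S + 2 \<le> card I}"
  define P where "P = insert {} ((\<lambda>k. {k}) ` I \<union> F)"
  have fin: "finite F" "finite P"
    using I(1) by (auto simp: F_def P_def intro: finite_subset[of _ "Pow I"])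
  have P_iff: "S \<in> P \<longleftrightarrow> S \<subseteq> I \<and> (card S \<le> 1 \<or> m \<notin> S \<and> card S + 2 \<le> card I)" for S
  proof
    assume "S \<in> P"
    then show "S \<subseteq> I \<and> (card S \<le> 1 \<or> m \<notin> S \<and> card S + 2 \<le> card I)"
      by (auto simp: P_def F_def)
  next
    assume S: "S \<subseteq> I \<and> (card S \<le> 1 \<or> m \<notin> S \<and> card S + 2 \<le> card I)"
    then have "finite S" using I(1) finite_subset by blast
    show "S \<in> P"
    proof (cases "card S \<le> 1")
      case True
      then have "S = {} \<or> (\<exists>k. S = {k})"
        using \<open>finite S\<close> by (metis One_nat_def card_0_eq card_1_singletonE le_Suc_eq le_zero_eq)
      then show ?thesis using S by (auto simp: P_def)
    next
      case False
      then show ?thesis using S by (auto simp: P_def F_def)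
    qed
  qed
  have card_compl: "card (I - S) = card I - card S" "card S \<le> card I" if "S \<subseteq> I" for S
    using that I(1) by (auto simp: card_Diff_subset finite_subset card_mono)
  have compl_image: "(\<lambda>S. I - S) ` P = {S. S \<subseteq> I \<and> S \<notin> P}"
  proof (intro equalityI subsetI)
    fix S assume "S \<in> (\<lambda>S. I - S) ` P"
    then obtain R where R: "S = I - R" "R \<in> P" by blast
    then show "S \<in> {S. S \<subseteq> I \<and> S \<notin> P}"
      using card_compl[of R] I(2) m by (auto simp: P_iff)
  next
    fix S assume "S \<in> {S. S \<subseteq> I \<and> S \<notin> P}"
    then have "S \<subseteq> I" "I - S \<in> P"
      using card_compl[of S] I(2) m by (auto simp: P_iff)
    then show "S \<in> (\<lambda>S. I - S) ` P" by (auto intro!: image_eqI[of S _ "I - S"])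
  qed
  have inj: "inj_on (\<lambda>S. I - S) P"
    by (intro inj_onI) (auto simp: P_iff)
  have "Pow I = P \<union> (\<lambda>S. I - S) ` P" "P \<inter> (\<lambda>S. I - S) ` P = {}"
    by (auto simp: compl_image P_iff)
  then have "(\<lambda>H. \<Sum>S\<in>Pow I. f S H) = (\<lambda>H. (\<Sum>S\<in>P. f S H) + (\<Sum>S\<in>P. f (I - S) H))"
    using fin by (auto simp: sum.union_disjoint sum.reindex[OF inj])
  moreover have "eqv \<dots> (\<lambda>H. (\<Sum>S\<in>P. f S H) + (\<Sum>S\<in>P. f S H))"
    by (intro eqv_add eqv_refl eqv_sum eqv_sym[OF compl]) (simp add: P_iff)
  moreover have "(\<Sum>S\<in>P. f S H) = f {} H + ((\<Sum>k\<in>I. f {k} H) + (\<Sum>S\<in>F. f S H))" for H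
  proof -
    have "(\<Sum>S\<in>P. f S H) = f {} H + (\<Sum>S\<in>(\<lambda>k. {k}) ` I \<union> F. f S H)"
      unfolding P_def using I(1) fin(1) by (intro sum.insert) (auto simp: F_def)
    also have "(\<Sum>S\<in>(\<lambda>k. {k}) ` I \<union> F. f S H) = (\<Sum>S\<in>(\<lambda>k. {k}) ` I. f S H) + (\<Sum>S\<in>F. f S H)"
      using I(1) fin(1) by (intro sum.union_disjoint) (auto simp: F_def)
    also have "(\<Sum>S\<in>(\<lambda>k. {k}) ` I. f S H) = (\<Sum>k\<in>I. f {k} H)"
      by (simp add: sum.reindex)
    finally show ?thesis .
  qed
  ultimately show ?thesis by (simp add: F_def algebra_simps)
qed

text \<open>No edge moves, so the new vertex is a leaf at \<open>v\<close>. Its edge stands first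
  here but last in \<open>ins_into_edge\<close>; moving it past all the others gives the
  sign.\<close>

lemma eqv_split_empty:
  assumes wf: "wf_graph (n, es)" and v: "v < n"
  shows "eqv (ind (split_graph (n, es) v {})) (\<lambda>H. (-1) ^ length es * ind (Suc n, es @ [{v, n}]) H)"
proof -
  have "split_graph (n, es) v {} = (Suc n, [] @ {v, n} # es)"
    by (simp add: split_graph_Pair map_nth)
  then show ?thesis
    using eqv_rotate[of "Suc n" "[]" "{v, n}" es] wf_split_graph[OF wf v, of "{}"] by simp
qed

text \<open>Moving a single edge across subdivides it: one half is the new edge, the other half
  takes over position \<open>k\<close>.\<close>

lemma split_graph_single:
  assumes "k < length es" "es ! k = {a, b}" "a \<noteq> b"
  shows "split_graph (n, es) a {k} = (Suc n, {a, n} # es[k := {b, n}])"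
proof -
  have "insert n (es ! k - {a}) = {b, n}" using assms(2,3) by auto
  then have "map (\<lambda>i. if i \<in> {k} then insert n (es ! i - {a}) else es ! i) [0..<length es] = es[k := {b, n}]"
    using assms by (intro nth_equalityI) (auto simp: nth_list_update)
  then show ?thesis by (simp add: split_graph_Pair)
qed

text \<open>Subdividing from \<open>a\<close> and subdividing from \<open>b\<close> give the same
  graph with the two halves exchanged in the edge order, which is a transposition.\<close>

lemma eqv_split_single:
  assumes wf: "wf_graph (n, es)" and k: "k < length es" and e: "es ! k = {a, b}" "a \<noteq> b"
  shows "eqv (\<lambda>H. \<Sum>v\<in>es ! k. ind (split_graph (n, es) v {k}) H) (\<lambda>_. 0)"
proof -
  have "a < n" "a \<in> es ! k" using edge_less[OF wf k, of a] e by simp_all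
  then have "wf_graph (split_graph (n, es) a {k})"
    using k by (intro wf_split_graph[OF wf]) (auto simp: incident_def)
  then have "wf_graph (Suc n, {a, n} # es[k := {b, n}])"
    by (simp add: split_graph_single[OF k e])
  from eqv_transpose_edges[OF this, of 0 "Suc k"] k
  have "eqv (ind (Suc n, {a, n} # es[k := {b, n}])) (\<lambda>H. - ind (Suc n, {b, n} # es[k := {a, n}]) H)"
    by simp
  moreover have "split_graph (n, es) b {k} = (Suc n, {b, n} # es[k := {a, n}])"
    using e by (intro split_graph_single[OF k]) auto
  ultimately show ?thesis
    using e split_graph_single[OF k e, of n] by (simp add: eqv_def)
qed

text \<open>Summing over incident pairs edge by edge instead of vertex by vertex brings the two
  subdivisions of each edge together.\<close>

lemma eqv_split_singles:
  assumes wf: "wf_graph (n, es)"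
  shows "eqv (\<lambda>H. \<Sum>v<n. \<Sum>k\<in>incident es v. ind (split_graph (n, es) v {k}) H) (\<lambda>_. 0)"
proof -
  have ends: "{v \<in> {..<n}. v \<in> es ! k} = es ! k" if "k < length es" for k
    using edge_less[OF wf that] by auto
  have "(\<lambda>H. \<Sum>v<n. \<Sum>k\<in>incident es v. ind (split_graph (n, es) v {k}) H) =
      (\<lambda>H. \<Sum>k<length es. \<Sum>v\<in>es ! k. ind (split_graph (n, es) v {k}) H)"
  proof
    fix H
    have "(\<Sum>v<n. \<Sum>k\<in>incident es v. ind (split_graph (n, es) v {k}) H) =
        (\<Sum>v<n. \<Sum>k | k \<in> {..<length es} \<and> v \<in> es ! k. ind (split_graph (n, es) v {k}) H)"
      by (simp add: incident_def)
    also have "\<dots> = (\<Sum>k<length es. \<Sum>v | v \<in> {..<n} \<and> v \<in> es ! k. ind (split_graph (n, es) v {k}) H)"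
      by (rule sum.swap_restrict) simp_all
    also have "\<dots> = (\<Sum>k<length es. \<Sum>v\<in>es ! k. ind (split_graph (n, es) v {k}) H)"
      using ends by (intro sum.cong refl) auto
    finally show "(\<Sum>v<n. \<Sum>k\<in>incident es v. ind (split_graph (n, es) v {k}) H) = \<dots>" .
  qed
  moreover have "eqv (\<lambda>H. \<Sum>k<length es. \<Sum>v\<in>es ! k. ind (split_graph (n, es) v {k}) H)
      (\<lambda>H. \<Sum>k<length es. 0)"
  proof (rule eqv_sum)
    fix k assume "k \<in> {..<length es}"
    then have k: "k < length es" by simp
    obtain a b where "es ! k = {a, b}" "a \<noteq> b"
      using wf_graph_edgeE[OF wf nth_mem[OF k]] .
    then show "eqv (\<lambda>H. \<Sum>v\<in>es ! k. ind (split_graph (n, es) v {k}) H) (\<lambda>H. 0)"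
      by (rule eqv_split_single[OF wf k])
  qed
  ultimately show ?thesis by simp
qed

lemma eqv_d_graph:
  assumes wf: "wf_graph (n, es)" and deg: "\<And>v. v < n \<Longrightarrow> 3 \<le> card (incident es v)"
  shows "eqv (d_graph (n, es))
    (\<lambda>H. 2 * (\<Sum>v<n. \<Sum>S\<in>half_splits es v. ind (split_graph (n, es) v S) H))"
proof -
  let ?f = "\<lambda>v S. ind (split_graph (n, es) v S)"
  let ?h = "\<lambda>v H. \<Sum>S\<in>half_splits es v. ?f v S H"
  let ?l = "\<lambda>v H. (-1) ^ length es * ind (Suc n, es @ [{v, n}]) H"
  have vertex: "eqv (\<lambda>H. \<Sum>S\<in>Pow (incident es v). ?f v S H)
      (\<lambda>H. 2 * (?f v {} H + (\<Sum>k\<in>incident es v. ?f v {k} H) + ?h v H))" if v: "v < n" for v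
  proof -
    have "incident es v \<noteq> {}" using deg[OF v] by auto
    then show ?thesis
      using deg[OF v] eqv_split_compl[OF wf v] unfolding half_splits_def
      by (intro eqv_sum_Pow) simp_all
  qed
  have "eqv (ins edge_graph (n, es)) (\<lambda>H. \<Sum>v<n. \<Sum>S\<in>Pow (incident es v). ?f v S H)"
    by (rule eqv_ins_edge[OF wf])
  also have "eqv \<dots> (\<lambda>H. \<Sum>v<n. 2 * (?f v {} H + (\<Sum>k\<in>incident es v. ?f v {k} H) + ?h v H))"
    using vertex by (intro eqv_sum) simp
  also have "\<dots> = (\<lambda>H. 2 * ((\<Sum>v<n. ?f v {} H) + (\<Sum>v<n. \<Sum>k\<in>incident es v. ?f v {k} H) + (\<Sum>v<n. ?h v H)))"
    by (simp add: sum.distrib sum_distrib_left[symmetric])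
  also have "eqv \<dots> (\<lambda>H. 2 * ((\<Sum>v<n. ?l v H) + 0 + (\<Sum>v<n. ?h v H)))"
    using eqv_split_empty[OF wf] by (intro eqv_smult eqv_add eqv_sum eqv_split_singles[OF wf]) simp_all
  finally have "eqv (ins edge_graph (n, es)) (\<lambda>H. 2 * ((\<Sum>v<n. ?l v H) + 0 + (\<Sum>v<n. ?h v H)))" .
  \<comment> \<open>Leaves occur twice because of the complementary pairs, and twice because of the
    two vertices of the edge graph, with the same power of -1; the two contributions cancel
    exactly.\<close>
  then have "eqv (d_graph (n, es)) (\<lambda>H. 2 * ((\<Sum>v<n. ?l v H) + 0 + (\<Sum>v<n. ?h v H)) -
      (-1) ^ length es * (2 * (\<Sum>u<n. ind (Suc n, es @ [{u, n}]) H)))"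
    unfolding d_graph_def ins_into_edge snd_conv by (intro eqv_diff eqv_refl)
  then show ?thesis by (simp add: sum_distrib_left[symmetric] algebra_simps)
qed

text \<open>\<open>dgc\<close> sums over the support, whereas a list may repeat graphs or have
  coefficients that cancel. Summing over all listed graphs instead adds only zero terms and makes
  linearity visible.\<close>

lemma dgc_sum_list:
  "dgc (\<lambda>H. \<Sum>(c, G)\<leftarrow>ts. c * ind G H) = (\<lambda>H. \<Sum>(c, G)\<leftarrow>ts. c * d_graph G H)"
proof
  fix H
  let ?c = "\<lambda>ts G. \<Sum>(c, G')\<leftarrow>ts. c * ind G' G"
  have "?c ts G = 0" if "G \<notin> snd ` set ts" for G
    using that by (induction ts) (auto simp: ind_def)
  then have "supp (?c ts) \<subseteq> snd ` set ts" by (auto simp: supp_def)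
  then have "dgc (?c ts) H = (\<Sum>G\<in>snd ` set ts. ?c ts G * d_graph G H)"
    unfolding dgc_def d_graph_def by (intro sum.mono_neutral_left) (auto simp: supp_def)
  moreover have "(\<Sum>G\<in>A. ?c ts G * d_graph G H) = (\<Sum>(c, G)\<leftarrow>ts. c * d_graph G H)"
    if "finite A" "snd ` set ts \<subseteq> A" for A
    using that
  proof (induction ts)
    case (Cons t ts)
    obtain c G where t: "t = (c, G)" by (cases t)
    have "(\<Sum>G'\<in>A. c * ind G G' * d_graph G' H) = (\<Sum>G'\<in>A. if G' = G then c * d_graph G H else 0)"
      by (intro sum.cong) (auto simp: ind_def)
    also have "\<dots> = c * d_graph G H" using Cons.prems t by simp
    finally show ?case
      using Cons t by (simp add: distrib_right sum.distrib)
  qed simp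
  ultimately show "dgc (?c ts) H = (\<Sum>(c, G)\<leftarrow>ts. c * d_graph G H)" by simp
qed

section \<open>Evaluation of splittings\<close>

definition pair_graph :: "nat \<Rightarrow> (nat \<times> nat) list \<Rightarrow> graph" where
  "pair_graph n ps = (n, map (\<lambda>(a, b). {a, b}) ps)"

text \<open>Increasing pairs represent each edge uniquely, so distinctness of the pairs is
  distinctness of the unordered edges.\<close>

definition valid_pairs :: "nat \<Rightarrow> (nat \<times> nat) list \<Rightarrow> bool" where
  "valid_pairs n ps \<longleftrightarrow> distinct ps \<and> list_all (\<lambda>(a, b). a < b \<and> b < n) ps"

definition incident_list :: "(nat \<times> nat) list \<Rightarrow> nat \<Rightarrow> nat list" where
  "incident_list ps v = filter (\<lambda>k. fst (ps ! k) = v \<or> snd (ps ! k) = v) [0..<length ps]"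

definition move_end :: "nat \<Rightarrow> nat \<Rightarrow> nat \<times> nat \<Rightarrow> nat \<times> nat" where
  "move_end n v e = (if fst e = v then n else fst e, if snd e = v then n else snd e)"

definition split_pairs :: "nat \<Rightarrow> (nat \<times> nat) list \<Rightarrow> nat \<Rightarrow> nat list \<Rightarrow> (nat \<times> nat) list" where
  "split_pairs n ps v S =
     (v, n) # map (\<lambda>k. if k \<in> set S then move_end n v (ps ! k) else ps ! k) [0..<length ps]"

definition vertex_splits :: "nat \<Rightarrow> (nat \<times> nat) list \<Rightarrow> nat \<Rightarrow> (nat \<times> nat) list list" where
  "vertex_splits n ps v = (let L = incident_list ps v in
     map (split_pairs n ps v)
       (filter (\<lambda>S. 2 \<le> length S \<and> length S + 2 \<le> length L) (subseqs (tl L))))"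

definition all_splits :: "nat \<Rightarrow> (nat \<times> nat) list \<Rightarrow> (nat \<times> nat) list list" where
  "all_splits n ps = concat (map (vertex_splits n ps) [0..<n])"

definition relabel_pair :: "nat list \<Rightarrow> nat \<times> nat \<Rightarrow> nat \<times> nat" where
  "relabel_pair p e = (let x = p ! fst e; y = p ! snd e in if x < y then (x, y) else (y, x))"

definition less_pair :: "nat \<times> nat \<Rightarrow> nat \<times> nat \<Rightarrow> bool" where
  "less_pair x y \<longleftrightarrow> fst x < fst y \<or> fst x = fst y \<and> snd x < snd y"

text \<open>One step of an insertion sort that negates the coefficient \<open>c\<close> with every
  edge passed. The first component of the result is the coefficient of the reordered graph rather
  than a bare sign.\<close>

fun insert_sign :: "nat \<times> nat \<Rightarrow> int \<Rightarrow> (nat \<times> nat) list \<Rightarrow> int \<times> (nat \<times> nat) list" where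
  "insert_sign e c [] = (c, [e])"
| "insert_sign e c (x # xs) = (if less_pair e x then (c, e # x # xs)
     else (case insert_sign e (- c) xs of (c', ys) \<Rightarrow> (c', x # ys)))"

fun sort_sign :: "int \<Rightarrow> (nat \<times> nat) list \<Rightarrow> int \<times> (nat \<times> nat) list" where
  "sort_sign c [] = (c, [])"
| "sort_sign c (e # es) = (case sort_sign c es of (c', ys) \<Rightarrow> insert_sign e c' ys)"

definition relabelling :: "nat \<Rightarrow> nat list \<Rightarrow> bool" where
  "relabelling n p \<longleftrightarrow> length p = n \<and> distinct p \<and> list_all (\<lambda>x. x < n) p"

text \<open>A list that is not a permutation leaves the term as it is, so the result is sound
  whatever relabelling is supplied.\<close>

definition canon :: "nat \<Rightarrow> nat list \<Rightarrow> int \<Rightarrow> (nat \<times> nat) list \<Rightarrow> int \<times> (nat \<times> nat) list" where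
  "canon n p c es = (if relabelling n p then sort_sign c (map (relabel_pair p) es) else (c, es))"

fun less_pairs :: "(nat \<times> nat) list \<Rightarrow> (nat \<times> nat) list \<Rightarrow> bool" where
  "less_pairs (x # xs) (y # ys) \<longleftrightarrow> (if x = y then less_pairs xs ys else less_pair x y)"
| "less_pairs _ _ \<longleftrightarrow> False"

text \<open>Soundness never uses that the tree is sorted: the order of the keys only makes equal keys
  meet.\<close>

datatype chain_tree = Leaf | Node chain_tree int "(nat \<times> nat) list" chain_tree

fun add_term :: "int \<Rightarrow> (nat \<times> nat) list \<Rightarrow> chain_tree \<Rightarrow> chain_tree" where
  "add_term c k Leaf = Node Leaf c k Leaf"
| "add_term c k (Node l d m r) = (if k = m then Node l (c + d) m r
     else if less_pairs k m then Node (add_term c k l) d m r else Node l d m (add_term c k r))"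

fun all_zero :: "chain_tree \<Rightarrow> bool" where
  "all_zero Leaf \<longleftrightarrow> True"
| "all_zero (Node l c _ r) \<longleftrightarrow> c = 0 \<and> all_zero l \<and> all_zero r"

text \<open>A second relabelling with the same result up to sign certifies that a graph has an odd
  automorphism, hence is zero in the graph complex.\<close>

fun add_reduced :: "nat \<Rightarrow> int \<Rightarrow> (nat \<times> nat) list \<Rightarrow> nat list list \<Rightarrow> chain_tree \<Rightarrow> chain_tree" where
  "add_reduced n c es [p] t = (case canon n p c es of (d, k) \<Rightarrow> add_term d k t)"
| "add_reduced n c es [p, q] t = (case canon n p c es of (d, k) \<Rightarrow>
     if canon n q (- c) es = (d, k) then t else add_term d k t)"
| "add_reduced n c es _ t = add_term c es t"

fun add_splits :: "nat \<Rightarrow> int \<Rightarrow> (nat \<times> nat) list list \<Rightarrow> nat list list list \<Rightarrow> chain_tree \<Rightarrow> chain_tree" where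
  "add_splits n c [] pss t = t"
| "add_splits n c (es # ess) pss t = add_splits n c ess (tl pss) (add_reduced n c es (hd pss) t)"

fun add_graphs :: "nat \<Rightarrow> (int \<times> (nat \<times> nat) list) list \<Rightarrow> nat list list list list \<Rightarrow> chain_tree \<Rightarrow> chain_tree" where
  "add_graphs n [] psss t = t"
| "add_graphs n ((c, es) # gs) psss t =
     add_graphs n gs (tl psss) (add_splits (Suc n) c (all_splits n es) (hd psss) t)"

fun chain_of :: "nat \<Rightarrow> chain_tree \<Rightarrow> chain" where
  "chain_of n Leaf = (\<lambda>_. 0)"
| "chain_of n (Node l c es r) =
     (\<lambda>H. chain_of n l H + of_int c * ind (pair_graph n es) H + chain_of n r H)"

section \<open>Soundness of the executable evaluation\<close>

lemma valid_pairs_nth: "valid_pairs n ps \<Longrightarrow> k < length ps \<Longrightarrow> fst (ps ! k) < snd (ps ! k) \<and> snd (ps ! k) < n"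
  by (cases "ps ! k") (auto simp: valid_pairs_def list_all_length)

lemma wf_pair_graph:
  assumes "valid_pairs n ps"
  shows "wf_graph (pair_graph n ps)"
proof -
  have less: "a < b \<and> b < n" if "(a, b) \<in> set ps" for a b
    using assms that by (auto simp: valid_pairs_def list_all_iff)
  have "inj_on (\<lambda>(a, b). {a, b}) (set ps)"
    by (auto simp: inj_on_def doubleton_eq_iff dest!: less)
  moreover have "\<exists>a b. {x, y} = {a, b} \<and> a \<noteq> b \<and> a < n \<and> b < n" if "(x, y) \<in> set ps" for x y
    using less[OF that] by (intro edge_exI[of _ x y]) auto
  ultimately show ?thesis
    using assms unfolding wf_graph_def pair_graph_def
    by (auto simp: distinct_map valid_pairs_def)
qed

lemma set_incident_list: "set (incident_list ps v) = incident (map (\<lambda>(a, b). {a, b}) ps) v"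
  by (auto simp: incident_list_def incident_def case_prod_unfold)

lemma distinct_incident_list: "distinct (incident_list ps v)"
  by (simp add: incident_list_def)

lemma sorted_incident_list: "sorted (incident_list ps v)"
  unfolding incident_list_def by (intro sorted_wrt_filter sorted_upt)

lemma set_tl_sorted:
  fixes xs :: "nat list"
  assumes "sorted xs" "distinct xs"
  shows "set (tl xs) = set xs - {Min (set xs)}"
proof (cases xs)
  case (Cons x ys)
  then have "Min (set xs) = x"
    using assms by (intro Min_eqI) auto
  then show ?thesis using Cons assms by auto
qed simp

lemma pair_graph_split_pairs:
  assumes ps: "valid_pairs n ps" and S: "set S \<subseteq> incident (map (\<lambda>(a, b). {a, b}) ps) v"
  shows "pair_graph (Suc n) (split_pairs n ps v S) = split_graph (pair_graph n ps) v (set S)"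
proof -
  let ?e = "\<lambda>e. {fst e, snd e} :: nat set"
  have "?e (if k \<in> set S then move_end n v (ps ! k) else ps ! k) =
      (if k \<in> set S then insert n (?e (ps ! k) - {v}) else ?e (ps ! k))" if k: "k < length ps" for k
  proof (cases "k \<in> set S")
    case True
    then have "fst (ps ! k) = v \<or> snd (ps ! k) = v"
      using S by (auto simp: incident_def case_prod_unfold)
    then show ?thesis
      using True valid_pairs_nth[OF ps k] by (auto simp: move_end_def)
  qed simp
  then show ?thesis
    by (simp add: pair_graph_def split_pairs_def split_graph_Pair case_prod_unfold)
qed

text \<open>The incident list is increasing, so its tail omits exactly the minimum excluded by
  \<open>half_splits\<close>, and the subsequences of a distinct list run through its subsets once
  each.\<close>

lemma sum_half_splits:
  assumes "valid_pairs n ps"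
  shows "(\<Sum>S\<in>half_splits (snd (pair_graph n ps)) v. ind (split_graph (pair_graph n ps) v S) H) =
    (\<Sum>qs\<leftarrow>vertex_splits n ps v. ind (pair_graph (Suc n) qs) H)"
proof -
  define L where "L = incident_list ps v"
  define Ss where "Ss = filter (\<lambda>S. 2 \<le> length S \<and> length S + 2 \<le> length L) (subseqs (tl L))"
  let ?I = "incident (map (\<lambda>(a, b). {a, b}) ps) v"
  have L: "distinct L" "sorted L" "set L = ?I"
    by (simp_all add: L_def distinct_incident_list sorted_incident_list set_incident_list)
  have tl: "distinct (tl L)" "set (tl L) = ?I - {Min ?I}"
    using set_tl_sorted[OF L(2,1)] L by (simp_all add: distinct_tl)
  have len: "length S = card (set S)" if "S \<in> set (subseqs (tl L))" for S
    using that tl(1) by (simp add: distinct_card subseqs_distinctD)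
  have "set ` set Ss = half_splits (map (\<lambda>(a, b). {a, b}) ps) v"
  proof -
    have "card ?I = length L" using L by (metis distinct_card)
    then have "half_splits (map (\<lambda>(a, b). {a, b}) ps) v =
        {S \<in> set ` set (subseqs (tl L)). 2 \<le> card S \<and> card S + 2 \<le> length L}"
      by (auto simp: half_splits_def subseqs_powset tl(2))
    also have "\<dots> = set ` set Ss"
      using len by (auto simp: Ss_def)
    finally show ?thesis ..
  qed
  moreover have "distinct (map set Ss)"
    using distinct_set_subseqs[OF tl(1)] by (auto simp: Ss_def distinct_map inj_on_def)
  moreover have "set S \<subseteq> ?I" if "S \<in> set Ss" for S
    using that subseqs_powset[of "tl L"] tl(2) by (auto simp: Ss_def)
  ultimately have "(\<Sum>S\<in>half_splits (map (\<lambda>(a, b). {a, b}) ps) v. ind (split_graph (pair_graph n ps) v S) H) =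
      (\<Sum>S\<leftarrow>Ss. ind (split_graph (pair_graph n ps) v (set S)) H)"
    using sum.distinct_set_conv_list[of "map set Ss" "\<lambda>S. ind (split_graph (pair_graph n ps) v S) H"]
    by (simp add: comp_def)
  also have "\<dots> = (\<Sum>S\<leftarrow>Ss. ind (pair_graph (Suc n) (split_pairs n ps v S)) H)"
    using pair_graph_split_pairs[OF assms] \<open>\<And>S. S \<in> set Ss \<Longrightarrow> set S \<subseteq> ?I\<close>
    by (intro arg_cong[where f = sum_list] map_cong) auto
  finally show ?thesis
    by (simp add: pair_graph_def vertex_splits_def Ss_def L_def Let_def comp_def)
qed

lemma eqv_d_pair_graph:
  assumes ps: "valid_pairs n ps" and deg: "\<And>v. v < n \<Longrightarrow> 3 \<le> length (incident_list ps v)"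
  shows "eqv (d_graph (pair_graph n ps))
    (\<lambda>H. 2 * (\<Sum>qs\<leftarrow>all_splits n ps. ind (pair_graph (Suc n) qs) H))"
proof -
  let ?es = "map (\<lambda>(a, b). {a, b}) ps"
  have "card (incident ?es v) = length (incident_list ps v)" for v
    by (metis distinct_card distinct_incident_list set_incident_list)
  then have "eqv (d_graph (n, ?es))
      (\<lambda>H. 2 * (\<Sum>v<n. \<Sum>S\<in>half_splits ?es v. ind (split_graph (n, ?es) v S) H))"
    using deg wf_pair_graph[OF ps] by (intro eqv_d_graph) (auto simp: pair_graph_def)
  moreover have "(\<Sum>v<n. \<Sum>S\<in>half_splits ?es v. ind (split_graph (n, ?es) v S) H) =
      (\<Sum>qs\<leftarrow>all_splits n ps. ind (pair_graph (Suc n) qs) H)" for H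
  proof -
    have "(\<Sum>v<n. \<Sum>S\<in>half_splits ?es v. ind (split_graph (n, ?es) v S) H) =
        (\<Sum>v<n. \<Sum>qs\<leftarrow>vertex_splits n ps v. ind (pair_graph (Suc n) qs) H)"
      using sum_half_splits[OF ps] by (simp add: pair_graph_def)
    also have "\<dots> = (\<Sum>v\<leftarrow>[0..<n]. \<Sum>qs\<leftarrow>vertex_splits n ps v. ind (pair_graph (Suc n) qs) H)"
      by (simp add: interv_sum_list_conv_sum_set_nat atLeast0LessThan)
    also have "\<dots> = (\<Sum>qs\<leftarrow>all_splits n ps. ind (pair_graph (Suc n) qs) H)"
    proof -
      have "(\<Sum>v\<leftarrow>vs. \<Sum>q\<leftarrow>g v. f q) = (\<Sum>q\<leftarrow>concat (map g vs). f q)" for vs g and f :: "_ \<Rightarrow> real"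
        by (induction vs) simp_all
      then show ?thesis by (simp add: all_splits_def)
    qed
    finally show ?thesis .
  qed
  ultimately show ?thesis by (simp add: pair_graph_def)
qed

text \<open>The fresh label exceeds all the old ones, so moving the first component of a pair makes
  it decreasing and \<open>valid_pairs\<close> may be lost. Well-formedness is taken from the
  splitting of the underlying graph instead.\<close>

lemma wf_split_pairs:
  assumes ps: "valid_pairs n ps" and qs: "qs \<in> set (all_splits n ps)"
  shows "wf_graph (pair_graph (Suc n) qs)"
proof -
  obtain v S where v: "v < n" and S: "S \<in> set (subseqs (tl (incident_list ps v)))"
    and qs: "qs = split_pairs n ps v S"
    using qs by (auto simp: all_splits_def vertex_splits_def Let_def)
  have "set S \<subseteq> set (tl (incident_list ps v))"
    using S subseqs_powset[of "tl (incident_list ps v)"] by blast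
  also have "\<dots> \<subseteq> incident (map (\<lambda>(a, b). {a, b}) ps) v"
    unfolding set_incident_list[symmetric] by (cases "incident_list ps v") auto
  finally have "set S \<subseteq> incident (map (\<lambda>(a, b). {a, b}) ps) v" .
  then show ?thesis
    using wf_split_graph[OF wf_pair_graph[OF ps, unfolded pair_graph_def] v]
      pair_graph_split_pairs[OF ps] qs by (simp add: pair_graph_def)
qed

text \<open>The prefix \<open>ws\<close> is arbitrary because each edge that \<open>e\<close> passes
  joins it before the induction continues. The multiset clause carries well-formedness over to the
  sorted list.\<close>

lemma eqv_insert_sign:
  assumes "wf_graph (pair_graph n (ws @ e # xs))" "insert_sign e c xs = (c', ys)"
  shows "eqv (\<lambda>H. of_int c * ind (pair_graph n (ws @ e # xs)) H)
      (\<lambda>H. of_int c' * ind (pair_graph n (ws @ ys)) H)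
    \<and> mset ys = mset (e # xs)"
  using assms
proof (induction xs arbitrary: ws c c' ys)
  case (Cons x xs)
  show ?case
  proof (cases "less_pair e x")
    case True
    then show ?thesis using Cons.prems by auto
  next
    case False
    then obtain zs where zs: "insert_sign e (- c) xs = (c', zs)" "ys = x # zs"
      using Cons.prems(2) by (auto split: prod.splits)
    have "wf_graph (pair_graph n ((ws @ [x]) @ e # xs))"
      using Cons.prems(1) wf_graph_mset[of "map (\<lambda>(a, b). {a, b}) (ws @ x # e # xs)"
          "map (\<lambda>(a, b). {a, b}) (ws @ e # x # xs)" n]
      by (simp add: pair_graph_def)
    note IH = Cons.IH[OF this zs(1)]
    have "eqv (\<lambda>H. of_int c * ind (pair_graph n (ws @ e # x # xs)) H)
        (\<lambda>H. of_int c * - ind (pair_graph n (ws @ x # e # xs)) H)"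
      using Cons.prems(1) unfolding pair_graph_def map_append list.map by (intro eqv_smult eqv_swap)
    also have "\<dots> = (\<lambda>H. of_int (- c) * ind (pair_graph n ((ws @ [x]) @ e # xs)) H)"
      by simp
    also have "eqv \<dots> (\<lambda>H. of_int c' * ind (pair_graph n ((ws @ [x]) @ zs)) H)"
      using IH by blast
    finally show ?thesis using IH zs by simp
  qed
qed simp

lemma eqv_sort_sign:
  assumes "wf_graph (pair_graph n (ws @ xs))" "sort_sign c xs = (c', ys)"
  shows "eqv (\<lambda>H. of_int c * ind (pair_graph n (ws @ xs)) H)
      (\<lambda>H. of_int c' * ind (pair_graph n (ws @ ys)) H)
    \<and> mset ys = mset xs"
  using assms
proof (induction xs arbitrary: ws c c' ys)
  case (Cons x xs)
  obtain d zs where zs: "sort_sign c xs = (d, zs)" "insert_sign x d zs = (c', ys)"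
    using Cons.prems(2) by (auto split: prod.splits)
  have IH: "eqv (\<lambda>H. of_int c * ind (pair_graph n (ws @ x # xs)) H)
      (\<lambda>H. of_int d * ind (pair_graph n (ws @ x # zs)) H)" "mset zs = mset xs"
    using Cons.IH[of "ws @ [x]", OF _ zs(1)] Cons.prems(1) by simp_all
  have "wf_graph (pair_graph n (ws @ x # zs))"
    using Cons.prems(1) wf_graph_mset[of "map (\<lambda>(a, b). {a, b}) (ws @ x # zs)"
        "map (\<lambda>(a, b). {a, b}) (ws @ x # xs)" n] IH(2)
    by (simp add: pair_graph_def)
  from eqv_insert_sign[OF this zs(2)] show ?case
    using IH by (auto intro: eqv_trans)
qed simp

lemma eqv_canon:
  assumes wf: "wf_graph (pair_graph n es)" and c: "canon n p c es = (c', es')"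
  shows "eqv (\<lambda>H. of_int c * ind (pair_graph n es) H) (\<lambda>H. of_int c' * ind (pair_graph n es') H)"
proof (cases "relabelling n p")
  case p: True
  then have c: "sort_sign c (map (relabel_pair p) es) = (c', es')"
    using c by (simp add: canon_def)
  define \<pi> where "\<pi> x = (if x < n then p ! x else x)" for x
  have "inj_on \<pi> {0..<n}" "\<pi> ` {0..<n} \<subseteq> {0..<n}"
    using p by (auto simp: relabelling_def \<pi>_def inj_on_def nth_eq_iff_index_eq list_all_length)
  then have "bij_betw \<pi> {0..<n} {0..<n}" by (simp add: bij_betw_def endo_inj_surj)
  then have perm: "\<pi> permutes {0..<n}" by (rule bij_imp_permutes) (simp add: \<pi>_def)
  let ?e = "\<lambda>(a, b). {a, b} :: nat set"
  have "?e (relabel_pair p e) = \<pi> ` ?e e" if "e \<in> set es" for e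
  proof -
    have "?e e \<in> set (map ?e es)" using that by auto
    then obtain k where "k < length (map ?e es)" "map ?e es ! k = ?e e" by (metis in_set_conv_nth)
    then have "fst e < n" "snd e < n"
      using edge_less[OF wf[unfolded pair_graph_def], of k] by (auto simp: case_prod_unfold)
    then show ?thesis by (auto simp: relabel_pair_def \<pi>_def Let_def case_prod_unfold)
  qed
  then have map: "map ?e (map (relabel_pair p) es) = map ((`) \<pi>) (map ?e es)" by simp
  have "eqv (\<lambda>H. of_int c * ind (pair_graph n es) H)
      (\<lambda>H. of_int c * ind (pair_graph n (map (relabel_pair p) es)) H)"
    using eqv_relabel[OF wf[unfolded pair_graph_def] perm]
    unfolding pair_graph_def map by (rule eqv_smult)
  moreover have "wf_graph (pair_graph n ([] @ map (relabel_pair p) es))"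
    using wf_graph_relabel[OF wf[unfolded pair_graph_def] perm] unfolding pair_graph_def append_Nil map .
  from eqv_sort_sign[OF this c]
  have "eqv (\<lambda>H. of_int c * ind (pair_graph n (map (relabel_pair p) es)) H)
    (\<lambda>H. of_int c' * ind (pair_graph n es') H)" by simp
  ultimately show ?thesis by (rule eqv_trans)
next
  case False
  then show ?thesis using c by (simp add: canon_def)
qed

lemma chain_of_add_term: "chain_of n (add_term c k t) H = of_int c * ind (pair_graph n k) H + chain_of n t H"
  by (induction c k t rule: add_term.induct) (auto simp: algebra_simps)

lemma chain_of_add_reduced:
  assumes "wf_graph (pair_graph n es)"
  shows "eqv (\<lambda>H. of_int c * ind (pair_graph n es) H + chain_of n t H) (chain_of n (add_reduced n c es ps t))"
  using assms
proof (induction n c es ps t rule: add_reduced.induct)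
  case (1 n c es p t)
  obtain d k where dk: "canon n p c es = (d, k)" by (cases "canon n p c es")
  then show ?case
    using eqv_canon[OF 1 dk] by (auto simp: chain_of_add_term[abs_def] intro: eqv_add)
next
  case (2 n c es p q t)
  obtain d k where dk: "canon n p c es = (d, k)" by (cases "canon n p c es")
  note p = eqv_canon[OF 2 dk]
  show ?case
  proof (cases "canon n q (- c) es = (d, k)")
    case True
    \<comment> \<open>Both \<open>c\<close> and \<open>- c\<close> times the graph reduce to the
      same term. Subtracting shows that twice the multiple by \<open>c\<close> vanishes, and over
      the reals one may divide by 2.\<close>
    have "eqv (\<lambda>H. of_int c * ind (pair_graph n es) H) (\<lambda>_. 0)"
      using eqv_smult[OF eqv_diff[OF p eqv_canon[OF 2 True]], of "1 / 2"] by simp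
    from eqv_add[OF this eqv_refl[of "chain_of n t"]] show ?thesis using dk True by simp
  next
    case False
    then show ?thesis
      using dk p by (auto simp: chain_of_add_term[abs_def] intro: eqv_add)
  qed
qed (simp_all add: chain_of_add_term[abs_def])

text \<open>The list \<open>pss\<close> is arbitrary, even of the wrong length: \<open>hd\<close>
  and \<open>tl\<close> then merely supply some unknown relabelling, for which
  \<open>chain_of_add_reduced\<close> still holds.\<close>

lemma chain_of_add_splits:
  assumes "\<And>es. es \<in> set ess \<Longrightarrow> wf_graph (pair_graph n es)"
  shows "eqv (\<lambda>H. of_int c * (\<Sum>es\<leftarrow>ess. ind (pair_graph n es) H) + chain_of n t H)
    (chain_of n (add_splits n c ess pss t))"
  using assms
proof (induction ess arbitrary: pss t)
  case (Cons es ess)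
  let ?s = "\<lambda>H. of_int c * (\<Sum>es\<leftarrow>ess. ind (pair_graph n es) H)"
  have "eqv (\<lambda>H. ?s H + (of_int c * ind (pair_graph n es) H + chain_of n t H))
      (\<lambda>H. ?s H + chain_of n (add_reduced n c es (hd pss) t) H)"
    using Cons.prems by (intro eqv_add eqv_refl chain_of_add_reduced) simp
  also have "eqv \<dots> (chain_of n (add_splits n c (es # ess) pss t))"
    using Cons by simp
  finally show ?case by (simp add: algebra_simps)
qed simp

lemma chain_of_add_graphs:
  assumes "\<And>c es. (c, es) \<in> set gs \<Longrightarrow> valid_pairs n es"
  shows "eqv (\<lambda>H. (\<Sum>(c, es)\<leftarrow>gs. of_int c * (\<Sum>qs\<leftarrow>all_splits n es. ind (pair_graph (Suc n) qs) H)) +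
      chain_of (Suc n) t H)
    (chain_of (Suc n) (add_graphs n gs psss t))"
  using assms
proof (induction gs arbitrary: psss t)
  case (Cons g gs)
  obtain c es where g: "g = (c, es)" by (cases g)
  let ?s = "\<lambda>H. \<Sum>(c, es)\<leftarrow>gs. of_int c * (\<Sum>qs\<leftarrow>all_splits n es. ind (pair_graph (Suc n) qs) H)"
  let ?t = "add_splits (Suc n) c (all_splits n es) (hd psss) t"
  have "eqv (\<lambda>H. ?s H + (of_int c * (\<Sum>qs\<leftarrow>all_splits n es. ind (pair_graph (Suc n) qs) H) + chain_of (Suc n) t H))
      (\<lambda>H. ?s H + chain_of (Suc n) ?t H)"
    using Cons.prems g by (intro eqv_add eqv_refl chain_of_add_splits wf_split_pairs) auto
  also have "eqv \<dots> (chain_of (Suc n) (add_graphs n gs (tl psss) ?t))"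
    using Cons.prems by (intro Cons.IH) auto
  finally show ?case using g by (simp add: algebra_simps)
qed simp

lemma chain_of_all_zero: "all_zero t \<Longrightarrow> chain_of n t = (\<lambda>_. 0)"
  by (induction t) (simp_all add: fun_eq_iff)

section \<open>The cocycle condition\<close>

text \<open>The coefficients are multiplied by 16.\<close>

definition gamma7_scaled :: "(int \<times> (nat \<times> nat) list) list" where
  "gamma7_scaled = [
    (16, [(0,5), (0,6), (0,7), (1,2), (1,4), (1,7), (2,3), (2,7), (3,5), (3,7), (4,6), (4,7), (5,7), (6,7)]),
    (-42, [(0,1), (0,3), (0,7), (1,2), (1,6), (2,4), (2,6), (3,5), (3,7), (4,6), (4,7), (5,6), (5,7), (6,7)]),
    (-308, [(0,2), (0,3), (0,7), (1,2), (1,4), (1,7), (2,6), (3,5), (3,7), (4,5), (4,6), (5,6), (5,7), (6,7)]),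
    (-70, [(0,1), (0,2), (0,4), (1,3), (1,6), (2,4), (2,5), (3,5), (3,7), (4,6), (4,7), (5,6), (5,7), (6,7)]),
    (98, [(0,1), (0,2), (0,7), (1,3), (1,5), (2,6), (2,7), (3,5), (3,6), (4,5), (4,6), (4,7), (5,7), (6,7)]),
    (154, [(0,3), (0,6), (0,7), (1,2), (1,4), (1,5), (2,4), (2,6), (3,5), (3,7), (4,5), (4,7), (5,6), (6,7)]),
    (-210, [(0,1), (0,2), (0,7), (1,5), (1,6), (2,4), (2,7), (3,4), (3,5), (3,6), (4,5), (4,6), (5,7), (6,7)]),
    (14, [(0,1), (0,3), (0,7), (1,2), (1,6), (2,5), (2,7), (3,5), (3,7), (4,5), (4,6), (4,7), (5,6), (6,7)]),
    (70, [(0,1), (0,3), (0,4), (1,2), (1,6), (2,4), (2,5), (3,5), (3,7), (4,6), (4,7), (5,6), (5,7), (6,7)]),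
    (-98, [(0,1), (0,2), (0,3), (1,6), (1,7), (2,5), (2,7), (3,5), (3,6), (4,5), (4,6), (4,7), (5,7), (6,7)]),
    (140, [(0,1), (0,2), (0,7), (1,4), (1,6), (2,3), (2,5), (3,6), (3,7), (4,5), (4,7), (5,6), (5,7), (6,7)]),
    (-119, [(0,1), (0,2), (0,3), (1,4), (1,5), (2,5), (2,7), (3,4), (3,6), (4,6), (4,7), (5,6), (5,7), (6,7)]),
    (98, [(0,1), (0,2), (0,4), (1,3), (1,7), (2,5), (2,7), (3,6), (3,7), (4,5), (4,6), (5,6), (5,7), (6,7)]),
    (308, [(0,1), (0,2), (0,3), (1,2), (1,7), (2,6), (3,5), (3,7), (4,5), (4,6), (4,7), (5,6), (5,7), (6,7)]),
    (-98, [(0,1), (0,4), (0,6), (1,4), (1,5), (2,4), (2,5), (2,7), (3,4), (3,6), (3,7), (5,6), (5,7), (6,7)]),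
    (-196, [(0,2), (0,4), (0,7), (1,3), (1,5), (1,7), (2,6), (2,7), (3,5), (3,6), (4,5), (4,6), (5,7), (6,7)]),
    (-196, [(0,2), (0,3), (0,7), (1,4), (1,5), (1,7), (2,5), (2,7), (3,6), (3,7), (4,5), (4,6), (5,6), (6,7)]),
    (-112, [(0,1), (0,3), (0,7), (1,2), (1,7), (2,4), (2,6), (3,5), (3,7), (4,5), (4,6), (5,6), (5,7), (6,7)]),
    (-112, [(0,1), (0,3), (0,7), (1,2), (1,7), (2,5), (2,7), (3,5), (3,6), (4,5), (4,6), (4,7), (5,6), (6,7)]),
    (98, [(0,1), (0,4), (0,5), (1,4), (1,6), (2,4), (2,5), (2,7), (3,5), (3,6), (3,7), (4,7), (5,6), (6,7)]),
    (98, [(0,1), (0,3), (0,7), (1,2), (1,7), (2,5), (2,6), (3,5), (3,6), (4,5), (4,6), (4,7), (5,7), (6,7)]),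
    (-112, [(0,1), (0,2), (0,4), (1,5), (1,6), (2,4), (2,5), (3,4), (3,6), (3,7), (4,7), (5,6), (5,7), (6,7)]),
    (112, [(0,1), (0,2), (0,7), (1,3), (1,7), (2,4), (2,7), (3,5), (3,6), (4,6), (4,7), (5,6), (5,7), (6,7)]),
    (-112, [(0,1), (0,2), (0,7), (1,4), (1,5), (2,6), (2,7), (3,4), (3,5), (3,6), (4,5), (4,6), (5,7), (6,7)]),
    (154, [(0,1), (0,3), (0,5), (1,2), (1,4), (2,5), (2,6), (3,4), (3,7), (4,6), (4,7), (5,6), (5,7), (6,7)]),
    (-112, [(0,2), (0,5), (0,6), (1,3), (1,4), (1,5), (2,4), (2,6), (3,4), (3,7), (4,7), (5,6), (5,7), (6,7)]),
    (196, [(0,3), (0,4), (0,6), (1,2), (1,5), (1,7), (2,6), (2,7), (3,5), (3,7), (4,5), (4,6), (5,7), (6,7)]),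
    (-294, [(0,1), (0,5), (0,7), (1,6), (1,7), (2,3), (2,5), (2,7), (3,5), (3,6), (4,5), (4,6), (4,7), (6,7)]),
    (-42, [(0,1), (0,4), (0,5), (1,6), (1,7), (2,4), (2,5), (2,7), (3,4), (3,5), (3,6), (4,6), (5,7), (6,7)]),
    (-70, [(0,1), (0,3), (0,7), (1,2), (1,6), (2,4), (2,5), (3,4), (3,5), (4,6), (4,7), (5,6), (5,7), (6,7)]),
    (-196, [(0,3), (0,4), (0,5), (1,2), (1,5), (1,7), (2,6), (2,7), (3,5), (3,7), (4,6), (4,7), (5,6), (6,7)]),
    (210, [(0,1), (0,4), (0,7), (1,2), (1,7), (2,3), (2,6), (3,5), (3,7), (4,5), (4,6), (5,6), (5,7), (6,7)]),
    (-98, [(0,1), (0,3), (0,6), (1,2), (1,5), (2,6), (2,7), (3,5), (3,7), (4,5), (4,6), (4,7), (5,7), (6,7)]),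
    (49, [(0,1), (0,5), (0,7), (1,4), (1,6), (2,4), (2,5), (2,6), (3,4), (3,5), (3,7), (4,6), (5,7), (6,7)]),
    (112, [(0,1), (0,2), (0,7), (1,4), (1,6), (2,4), (2,5), (3,5), (3,6), (3,7), (4,5), (4,6), (5,7), (6,7)]),
    (-112, [(0,1), (0,3), (0,7), (1,4), (1,7), (2,3), (2,5), (2,7), (3,6), (4,6), (4,7), (5,6), (5,7), (6,7)]),
    (-77, [(0,1), (0,5), (0,7), (1,4), (1,6), (2,4), (2,5), (2,6), (3,4), (3,5), (3,7), (4,7), (5,6), (6,7)]),
    (308, [(0,1), (0,3), (0,7), (1,2), (1,6), (2,4), (2,7), (3,5), (3,6), (4,6), (4,7), (5,6), (5,7), (6,7)]),
    (280, [(0,1), (0,3), (0,4), (1,2), (1,6), (2,5), (2,7), (3,5), (3,7), (4,6), (4,7), (5,6), (5,7), (6,7)]),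
    (-210, [(0,1), (0,2), (0,7), (1,4), (1,6), (2,3), (2,5), (3,5), (3,7), (4,6), (4,7), (5,6), (5,7), (6,7)]),
    (-112, [(0,1), (0,4), (0,5), (1,4), (1,6), (2,4), (2,5), (2,7), (3,5), (3,6), (3,7), (4,6), (5,7), (6,7)]),
    (-147, [(0,1), (0,2), (0,5), (1,4), (1,7), (2,3), (2,6), (3,6), (3,7), (4,6), (4,7), (5,6), (5,7), (6,7)]),
    (-308, [(0,1), (0,2), (0,6), (1,4), (1,5), (2,4), (2,6), (3,4), (3,5), (3,7), (4,7), (5,6), (5,7), (6,7)]),
    (-98, [(0,1), (0,3), (0,6), (1,2), (1,6), (2,4), (2,7), (3,5), (3,7), (4,6), (4,7), (5,6), (5,7), (6,7)]),
    (-28, [(0,1), (0,2), (0,4), (1,5), (1,7), (2,4), (2,6), (3,4), (3,5), (3,6), (4,7), (5,6), (5,7), (6,7)]),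
    (-112, [(0,1), (0,3), (0,7), (1,2), (1,5), (2,5), (2,7), (3,6), (3,7), (4,5), (4,6), (4,7), (5,6), (6,7)])]"

text \<open>For the terms of \<open>gamma7_scaled\<close> and, within each, the graphs of \<open>all_splits\<close> in order: a
  relabelling of the nine vertices that brings the graph to a canonical form, followed by a
  second one if the graph has an odd automorphism.\<close>

definition split_relabellings :: "nat list list list list" where
  "split_relabellings = [
    [
    [[0,6,7,5,4,3,1,2,8]], [[0,7,6,4,5,1,3,2,8]], [[0,6,5,3,4,1,2,7,8]],
    [[0,5,7,6,1,4,2,3,8], [1,4,6,7,0,5,3,2,8]], [[1,4,6,5,2,3,0,7,8]], [[0,5,6,4,2,1,3,7,8]],
    [[6,1,0,2,3,4,5,8,7]], [[0,7,5,1,6,2,4,3,8], [1,6,4,0,7,3,5,2,8]], [[0,6,5,2,4,3,1,7,8]],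
    [[1,6,4,2,5,0,3,7,8]], [[6,0,1,3,2,5,4,8,7]], [[0,6,5,1,2,3,4,7,8]], [[5,1,0,3,4,2,6,8,7]],
    [[5,0,1,4,3,6,2,8,7]], [[7,0,1,4,3,6,5,8,2]], [[0,6,1,4,7,3,5,2,8]], [[0,6,2,5,4,3,1,7,8]],
    [[1,5,2,3,6,0,4,7,8]], [[6,0,3,2,1,5,4,8,7]], [[1,4,2,6,0,5,3,7,8]], [[4,2,3,0,5,1,6,8,7]],
    [[6,0,3,1,4,5,2,8,7]], [[7,0,2,1,4,5,6,8,3], [6,1,3,0,5,4,7,8,2]], [[2,4,1,0,6,3,5,7,8]],
    [[6,0,3,5,1,2,4,8,7]], [[4,1,3,5,0,6,2,8,7]], [[6,0,3,5,1,7,4,8,2]], [[4,1,5,6,3,2,0,8,7]],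
    [[6,0,3,4,5,1,7,8,2]], [[5,0,4,6,2,7,1,8,3], [4,1,5,7,3,6,0,8,2]], [[0,1,6,7,4,5,3,2,8]],
    [[1,2,5,6,3,4,0,7,8]], [[0,2,6,4,5,1,3,7,8]], [[6,3,0,1,2,4,5,8,7]], [[2,1,4,6,0,5,3,7,8]],
    [[4,3,1,0,5,2,6,8,7]], [[6,3,0,1,5,4,2,8,7]], [[6,3,0,1,5,4,7,8,2]], [[1,2,4,0,6,3,5,7,8]],
    [[6,3,0,4,1,2,5,8,7]], [[4,3,2,5,0,6,1,8,7]], [[7,2,0,4,1,6,5,8,3], [6,3,1,5,0,7,4,8,2]],
    [[4,5,1,3,6,0,2,8,7]], [[5,4,0,2,6,1,7,8,3], [4,5,1,3,7,0,6,8,2]], [[6,3,0,5,4,7,1,8,2]],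
    [[2,0,1,4,3,6,5,7,8]], [[4,5,3,0,2,1,6,8,7]], [[4,3,5,2,0,6,1,8,7]], [[7,4,3,0,1,5,6,8,2]],
    [[3,6,4,1,5,0,2,8,7]], [[4,5,3,0,7,1,6,8,2]], [[4,7,5,0,6,3,1,8,2]], [[3,4,6,5,1,2,0,8,7]],
    [[4,5,7,6,0,1,3,8,2]], [[4,3,5,7,0,6,1,8,2]], [[2,7,6,4,5,0,1,8,3], [3,6,7,5,4,1,0,8,2]]],
    [
    [[2,0,1,3,5,6,4,8,7]], [[3,0,2,5,6,4,1,8,7]], [[4,2,0,5,3,6,7,8,1]],
    [[3,0,1,5,4,6,2,8,7], [3,0,2,5,4,6,1,8,7]], [[3,1,0,5,6,4,7,8,2], [4,2,0,5,6,3,7,8,1]],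
    [[2,1,0,3,4,6,7,8,5], [2,1,0,3,5,6,7,8,4]], [[3,0,1,4,5,6,2,8,7]], [[4,1,0,6,3,5,7,8,2]],
    [[2,0,1,4,3,6,7,8,5]], [[2,0,1,3,5,4,7,8,6]], [[0,2,3,1,6,5,8,4,7]],
    [[0,3,5,1,6,4,8,2,7], [0,3,5,2,6,4,8,1,7]], [[1,3,5,0,4,6,8,7,2], [2,4,5,0,3,6,8,7,1]],
    [[0,3,5,2,4,6,8,1,7]], [[2,4,5,0,6,3,8,7,1]], [[1,2,3,0,6,4,8,7,5], [1,2,3,0,6,5,8,7,4]],
    [[0,3,4,1,6,5,8,2,7]], [[1,4,6,0,5,3,8,7,2]], [[0,2,3,1,4,5,8,7,6]], [[0,2,4,1,6,3,8,7,5]]],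
    [
    [[5,3,2,6,0,4,7,8,1]], [[5,3,1,6,0,2,7,8,4]], [[5,4,2,3,1,0,7,8,6]], [[5,3,0,6,1,7,4,8,2]],
    [[4,3,0,6,2,7,1,8,5]], [[4,3,1,6,2,7,0,8,5]], [[0,2,1,4,5,8,6,3,7]],
    [[0,2,1,3,5,7,8,4,6], [0,2,1,4,5,7,8,3,6]], [[3,0,2,4,5,8,7,6,1]], [[0,4,3,2,5,7,8,1,6]],
    [[2,0,1,5,4,7,8,6,3]], [[2,0,1,5,4,8,6,7,3]], [[0,1,3,4,5,8,7,2,6], [1,0,2,5,4,8,6,3,7]],
    [[0,3,1,2,5,7,8,6,4]], [[1,2,0,3,5,8,7,6,4]], [[1,2,0,3,4,8,7,6,5]]],
    [
    [[0,3,1,5,2,7,6,8,4], [0,3,2,5,1,8,6,7,4]], [[0,3,2,5,1,7,6,8,4]], [[0,3,2,5,1,6,7,8,4]],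
    [[0,2,1,4,6,3,7,8,5]], [[0,2,1,4,6,3,7,8,5], [5,3,4,1,8,2,7,6,0]], [[3,4,1,2,6,0,8,7,5]],
    [[1,0,4,3,6,7,2,8,5]], [[1,0,4,3,7,6,2,8,5]], [[1,0,4,3,6,7,2,8,5]], [[2,1,4,0,7,6,8,3,5]],
    [[3,1,4,0,7,6,8,2,5]], [[3,1,4,0,6,7,8,2,5]]],
    [
    [[4,0,6,2,5,3,7,8,1]], [[4,0,6,2,5,1,7,8,3]], [[3,0,5,2,6,1,7,8,4]], [[4,2,5,1,6,7,3,8,0]],
    [[5,2,4,1,6,7,0,8,3]], [[5,2,3,1,6,7,0,8,4]], [[0,1,2,4,5,7,6,3,8], [0,1,3,4,5,7,6,2,8]],
    [[0,1,3,4,5,6,8,2,7]], [[1,2,0,4,5,7,6,8,3]], [[0,1,3,4,5,6,7,2,8]], [[0,1,2,3,5,6,8,7,4]],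
    [[0,2,1,4,5,8,6,7,3]], [[0,3,1,4,5,7,6,2,8]], [[1,0,3,2,5,6,8,7,4]], [[0,1,2,3,5,8,6,7,4]],
    [[0,1,2,3,4,7,8,6,5], [1,0,3,2,5,6,8,7,4]]],
    [
    [[5,1,3,4,0,6,8,7,2], [5,2,3,4,0,6,8,7,1]], [[5,1,3,4,0,6,8,7,2]], [[5,1,2,4,0,6,8,7,3]],
    [[5,2,4,3,6,0,7,8,1]], [[5,2,4,3,6,0,7,8,1]], [[5,1,4,2,6,0,7,8,3]], [[2,5,3,4,8,7,0,6,1]],
    [[2,5,3,4,8,7,0,6,1]], [[1,5,2,4,8,7,0,6,3]], [[1,5,4,3,7,8,6,0,2]],
    [[1,5,4,3,7,8,6,0,2], [2,5,4,3,7,8,6,0,1]], [[1,5,4,2,7,8,6,0,3]]],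
    [
    [[3,5,1,4,0,7,6,8,2]], [[3,5,1,4,0,6,7,8,2]], [[2,5,1,3,0,6,7,8,4], [2,5,1,4,0,7,6,8,3]],
    [[3,1,4,5,7,0,8,6,2]], [[3,1,4,5,7,0,8,6,2]], [[2,1,5,4,7,0,8,6,3]], [[3,1,4,5,7,8,0,6,2]],
    [[3,1,4,5,7,8,0,6,2]], [[2,1,5,4,7,8,0,6,3]], [[0,4,2,5,8,7,6,1,3]], [[0,4,2,5,8,6,7,1,3]],
    [[0,3,2,5,8,6,7,1,4]]],
    [
    [[5,2,4,3,6,1,7,8,0]], [[5,2,3,4,6,0,7,8,1]], [[5,2,3,4,6,0,7,8,1]], [[3,0,4,6,5,7,2,8,1]],
    [[2,0,4,5,6,7,1,8,3]], [[2,0,3,6,4,7,1,8,5], [2,0,3,6,5,7,1,8,4]], [[0,1,4,3,5,8,7,2,6]],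
    [[0,2,4,3,5,7,8,1,6]], [[2,4,3,0,5,6,8,7,1]], [[0,3,4,1,5,6,8,2,7], [0,3,4,2,5,7,8,1,6]],
    [[3,1,0,4,5,7,8,6,2]], [[1,0,2,3,5,8,7,6,4]], [[0,2,3,4,5,7,8,1,6]], [[1,3,4,0,5,7,8,6,2]],
    [[0,1,3,2,5,8,7,6,4]], [[0,1,3,2,5,8,7,6,4]]],
    [
    [[0,1,4,5,2,8,6,7,3]], [[0,1,3,5,2,7,6,8,4]], [[0,2,3,4,1,7,6,8,5]],
    [[1,0,2,3,7,4,6,8,5], [4,5,3,2,8,1,6,7,0]], [[2,4,5,0,7,3,8,6,1]], [[3,4,1,2,6,0,8,7,5]],
    [[1,0,3,5,6,7,2,8,4]], [[1,0,3,4,6,7,2,8,5], [2,0,3,5,7,6,1,8,4]],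
    [[1,0,3,4,6,7,2,8,5], [2,0,3,5,6,7,1,8,4]], [[0,2,4,1,6,7,8,3,5], [1,3,5,0,7,6,8,2,4]],
    [[1,3,4,0,7,6,8,2,5]], [[1,3,4,0,6,7,8,2,5]]],
    [
    [[0,5,3,2,6,4,7,8,1]], [[0,5,3,2,6,1,7,8,4]], [[1,5,3,2,6,0,7,8,4]], [[0,3,5,2,6,7,4,8,1]],
    [[0,3,5,2,6,7,1,8,4]], [[1,3,5,2,6,7,0,8,4]], [[0,1,3,2,5,7,6,4,8]], [[0,1,3,2,5,6,7,4,8]],
    [[0,4,1,3,5,6,7,8,2]], [[0,1,4,3,5,7,6,2,8]], [[0,3,1,2,5,6,7,8,4]], [[0,3,1,2,5,7,6,8,4]],
    [[0,1,2,4,5,7,6,3,8]], [[0,3,1,2,5,6,8,7,4]], [[0,1,3,2,5,8,6,7,4]],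
    [[0,1,2,3,4,8,7,6,5], [0,3,2,1,5,6,7,8,4]]],
    [
    [[3,1,0,6,5,4,7,8,2], [4,2,0,6,5,3,7,8,1]], [[3,2,0,6,5,1,7,8,4]], [[3,2,0,5,4,1,7,8,6]],
    [[3,0,1,5,6,7,4,8,2], [4,0,2,5,6,7,3,8,1]], [[3,0,2,5,6,7,1,8,4]], [[3,0,2,4,5,7,1,8,6]],
    [[0,1,2,4,5,8,6,3,7]], [[0,2,1,5,4,6,8,3,7]], [[0,1,2,4,3,8,7,6,5]],
    [[0,1,3,5,4,6,7,2,8], [0,2,3,5,4,6,8,1,7]], [[0,2,1,3,4,7,8,6,5], [1,3,0,2,5,6,8,7,4]],
    [[0,2,1,3,5,8,6,7,4]], [[0,3,1,4,5,7,6,2,8], [0,3,2,4,5,8,6,1,7]], [[0,1,2,5,3,6,8,7,4]],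
    [[0,1,2,4,3,8,7,6,5], [1,0,3,5,2,8,6,7,4]], [[0,1,2,4,3,8,7,6,5]]],
    [
    [[0,2,5,1,4,7,6,8,3]], [[0,2,5,1,3,7,6,8,4]], [[0,2,4,3,1,6,7,8,5], [1,3,5,2,0,7,6,8,4]],
    [[0,2,1,5,7,3,8,6,4]], [[0,2,1,5,7,4,8,6,3]], [[0,2,3,4,6,1,8,7,5], [1,3,2,5,7,0,8,6,4]],
    [[0,3,4,1,6,7,2,8,5]], [[0,3,4,1,6,7,2,8,5]], [[0,3,4,1,6,7,2,8,5]], [[0,3,1,4,7,6,8,2,5]],
    [[0,3,1,4,7,6,8,2,5]], [[0,3,1,4,7,6,8,2,5]]],
    [
    [[0,4,3,6,1,5,7,8,2]], [[0,4,3,6,1,2,7,8,5]], [[0,4,3,6,2,1,7,8,5]], [[0,3,6,5,1,7,4,8,2]],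
    [[0,3,6,5,1,7,2,8,4]], [[0,3,5,4,2,7,1,8,6]], [[1,0,4,2,5,8,7,3,6], [1,0,5,3,4,8,6,2,7]],
    [[0,1,2,5,4,6,8,3,7], [1,0,3,4,5,7,8,2,6]], [[0,1,2,4,5,7,8,6,3]], [[1,0,5,2,4,8,6,3,7]],
    [[0,2,1,5,3,6,8,7,4]], [[0,1,2,4,3,8,7,6,5]], [[0,1,2,5,4,6,8,3,7]], [[0,1,3,2,4,7,8,6,5]],
    [[0,1,3,2,4,8,7,6,5]], [[0,1,2,4,3,7,8,6,5]]],
    [
    [[0,3,1,4,6,5,7,8,2]], [[0,3,1,4,6,2,7,8,5]], [[0,4,2,3,5,1,7,8,6], [0,4,2,3,6,1,7,8,5]],
    [[1,3,0,5,6,7,4,8,2]], [[1,3,0,5,6,7,2,8,4]], [[1,3,0,4,5,7,2,8,6], [1,3,0,4,6,7,2,8,5]],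
    [[1,0,2,4,5,8,6,3,7]], [[0,1,2,3,5,6,8,4,7]], [[0,1,2,3,5,8,7,6,4]], [[1,0,2,4,5,8,6,3,7]],
    [[0,1,2,3,5,7,8,6,4]], [[0,1,2,3,5,8,7,6,4], [0,2,1,3,5,8,6,7,4]],
    [[0,1,2,3,5,7,6,4,8], [1,0,2,4,5,8,6,3,7]], [[0,1,2,3,5,7,8,6,4]], [[0,1,2,3,5,8,7,6,4]],
    [[0,1,2,3,4,8,7,6,5], [0,1,2,3,5,8,7,6,4]]],
    [
    [[2,3,5,4,0,7,6,8,1]], [[2,3,4,5,0,7,6,8,1]], [[2,3,5,4,0,7,6,8,1]], [[3,1,4,5,6,0,8,7,2]],
    [[3,1,4,5,6,0,7,8,2]], [[4,1,2,5,6,0,8,7,3]], [[1,3,5,4,6,8,0,7,2]], [[1,3,5,4,6,7,0,8,2]],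
    [[1,4,5,2,6,8,0,7,3]], [[4,5,2,3,6,8,7,0,1]], [[5,4,2,3,6,7,8,0,1]], [[5,4,1,2,6,7,8,0,3]]],
    [
    [[5,4,6,1,2,3,7,8,0]], [[5,3,6,2,1,0,7,8,4], [5,4,6,2,1,0,7,8,3]], [[5,3,6,1,2,0,7,8,4]],
    [[4,6,5,2,1,7,3,8,0]], [[5,6,4,2,1,7,0,8,3]], [[5,6,4,1,2,7,0,8,3]],
    [[0,5,1,4,3,8,6,2,7], [0,5,2,4,3,8,6,1,7]], [[0,5,3,4,1,6,7,2,8]], [[3,2,0,4,5,7,6,8,1]],
    [[0,5,1,4,3,7,6,2,8]], [[1,0,5,3,4,6,8,7,2]], [[0,1,2,5,3,8,6,7,4], [1,0,5,2,4,7,6,8,3]],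
    [[0,2,4,5,3,6,7,1,8]], [[0,4,1,5,2,6,8,7,3]], [[1,5,0,4,3,8,6,7,2]], [[0,3,1,4,2,8,7,6,5]]],
    [
    [[5,4,3,6,1,2,7,8,0], [5,4,3,6,2,1,7,8,0]], [[5,3,4,6,1,0,7,8,2]], [[5,3,4,6,2,0,7,8,1]],
    [[4,5,6,3,1,7,2,8,0]], [[4,5,6,3,1,7,0,8,2]], [[3,5,6,2,1,7,0,8,4]],
    [[0,4,3,1,5,8,7,2,6], [0,4,3,2,5,8,7,1,6]], [[0,4,3,2,5,7,8,1,6]],
    [[2,3,0,4,5,6,8,7,1], [3,2,1,5,4,7,8,6,0]], [[0,4,2,3,5,7,8,1,6]], [[3,2,4,1,5,7,8,6,0]],
    [[0,1,2,3,5,7,8,6,4]], [[0,2,3,4,5,7,8,1,6]], [[1,4,0,3,5,7,8,6,2], [2,4,0,3,5,7,8,6,1]],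
    [[0,4,1,2,5,7,8,6,3]], [[0,4,2,1,5,8,7,6,3]]],
    [
    [[5,3,1,6,0,4,7,8,2]], [[6,4,1,5,0,2,7,8,3]], [[5,4,2,3,1,0,7,8,6]], [[5,4,0,6,1,7,3,8,2]],
    [[5,3,0,6,1,7,2,8,4], [5,3,0,6,2,7,1,8,4]], [[4,3,0,6,2,7,1,8,5]], [[0,1,2,4,5,8,7,3,6]],
    [[0,1,2,3,5,7,8,4,6], [0,1,2,4,5,7,8,3,6]], [[1,0,3,4,5,8,7,6,2], [2,0,3,4,5,8,7,6,1]],
    [[0,3,4,2,5,7,8,1,6]], [[1,0,2,4,5,7,8,6,3]], [[1,0,2,4,5,8,7,6,3], [2,0,1,5,4,8,6,7,3]],
    [[1,0,3,4,5,8,7,2,6]], [[0,1,3,2,5,7,8,6,4]], [[1,0,2,3,5,8,7,6,4]], [[1,0,2,3,4,8,7,6,5]]],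
    [
    [[3,5,4,1,6,2,7,8,0], [4,5,3,2,6,1,7,8,0]], [[4,5,3,2,6,0,7,8,1]], [[4,5,3,1,6,0,7,8,2]],
    [[3,4,6,0,5,7,2,8,1]], [[2,4,6,0,5,7,1,8,3]], [[2,3,6,1,4,7,0,8,5], [2,3,6,1,5,7,0,8,4]],
    [[0,1,4,3,5,8,7,2,6]], [[0,1,4,3,5,7,8,2,6]], [[3,0,2,4,5,7,8,6,1]],
    [[0,1,3,4,5,7,8,2,6], [0,2,3,4,5,7,8,1,6]], [[1,0,3,4,5,7,8,6,2], [2,0,3,5,4,7,8,6,1]],
    [[1,0,2,4,5,7,8,6,3], [1,0,3,4,5,8,7,6,2]], [[1,0,3,4,5,7,8,2,6]], [[2,0,1,4,5,7,8,6,3]],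
    [[1,0,2,4,5,7,8,6,3]], [[1,0,2,3,5,7,8,6,4]]],
    [
    [[3,2,4,5,1,7,8,6,0]], [[1,3,4,5,0,6,8,7,2]], [[1,2,4,5,0,6,8,7,3]], [[2,5,4,3,7,1,6,8,0]],
    [[1,4,5,3,7,0,6,8,2]], [[1,4,3,5,6,0,7,8,2]], [[4,2,5,3,8,6,0,7,1]], [[3,1,5,4,7,6,0,8,2]],
    [[4,1,5,2,7,6,0,8,3], [4,1,5,3,7,6,0,8,2]], [[5,4,2,3,6,8,7,1,0]], [[5,4,2,3,6,8,7,0,1]],
    [[4,5,1,3,6,7,8,0,2]]],
    [
    [[4,5,2,1,6,3,7,8,0]], [[5,4,1,2,6,0,7,8,3]], [[5,4,1,2,6,0,7,8,3]], [[4,5,2,1,6,7,3,8,0]],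
    [[5,4,1,2,6,7,0,8,3]], [[5,4,1,2,6,7,0,8,3]], [[0,1,4,3,5,8,6,2,7]], [[0,1,4,3,5,6,8,2,7]],
    [[1,0,3,4,5,6,7,8,2], [2,0,3,5,4,7,6,8,1]], [[0,1,4,3,5,6,7,2,8], [0,2,5,3,4,7,6,1,8]],
    [[1,0,3,4,5,6,8,7,2]], [[1,0,3,4,5,8,6,7,2]], [[0,1,4,3,5,6,7,2,8]], [[0,1,3,2,5,6,8,7,4]],
    [[0,1,3,2,5,8,6,7,4]], [[0,1,3,2,4,7,8,6,5], [1,0,2,3,5,8,7,6,4]]],
    [
    [[0,4,2,5,3,6,8,7,1], [1,5,3,4,2,7,8,6,0]], [[0,4,2,5,1,6,8,7,3]], [[1,4,2,5,0,6,8,7,3]],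
    [[0,2,1,5,6,4,7,8,3]], [[0,1,2,5,6,3,7,8,4]], [[3,2,1,5,6,0,7,8,4]], [[2,0,4,5,7,6,1,8,3]],
    [[2,0,4,5,7,6,1,8,3]], [[2,1,5,4,7,6,0,8,3]], [[0,5,2,3,6,8,7,1,4]],
    [[0,5,2,3,6,7,8,1,4], [0,5,2,4,6,7,8,1,3]], [[0,4,2,3,6,7,8,1,5], [1,5,3,2,6,8,7,0,4]]],
    [
    [[6,4,7,0,5,2,3,8,1], [7,5,6,1,4,3,2,8,0]], [[5,3,7,0,6,2,1,8,4]], [[6,4,7,0,5,2,1,8,3]],
    [[0,2,3,1,6,5,7,4,8]], [[0,3,5,1,6,2,7,4,8]], [[1,0,3,2,4,5,7,8,6]],
    [[0,5,3,2,1,6,7,4,8], [0,5,4,2,1,6,7,3,8]], [[1,0,3,2,5,4,7,8,6]], [[0,1,3,2,5,4,7,6,8]],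
    [[3,0,1,2,5,6,7,8,4], [4,0,1,2,5,6,7,8,3]], [[0,4,1,2,5,6,7,3,8]], [[1,0,3,2,5,4,7,8,6]],
    [[0,1,2,3,5,4,7,6,8]], [[4,0,5,1,2,6,7,8,3]], [[0,1,2,3,4,5,7,6,8]], [[4,0,5,1,6,2,7,8,3]],
    [[2,0,3,1,6,5,7,8,4]], [[1,0,4,2,6,5,7,3,8]], [[0,1,2,3,4,5,7,8,6], [1,0,3,2,5,4,6,8,7]],
    [[1,0,3,2,5,4,7,6,8]], [[4,5,0,2,1,6,7,8,3]], [[1,0,3,2,4,5,7,6,8]], [[4,5,0,2,6,1,7,8,3]],
    [[2,3,0,1,4,6,7,8,5], [2,3,0,1,5,6,7,8,4]], [[0,1,2,3,4,5,7,6,8]], [[6,4,5,1,2,0,7,8,3]],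
    [[4,2,3,0,1,5,7,8,6], [4,3,2,1,0,6,7,8,5]], [[3,2,4,0,6,1,7,8,5]]],
    [
    [[3,1,5,4,0,6,7,8,2]], [[3,1,5,4,0,6,7,8,2]], [[2,1,5,3,0,6,7,8,4], [2,1,5,4,0,6,7,8,3]],
    [[2,0,4,5,6,1,8,7,3], [3,1,5,4,7,0,8,6,2]], [[3,1,5,4,6,0,8,7,2]], [[2,1,5,4,6,0,8,7,3]],
    [[2,4,0,5,7,8,1,6,3]], [[2,4,0,5,7,8,1,6,3]], [[2,5,1,4,7,8,0,6,3]],
    [[0,4,1,5,8,7,6,2,3], [0,4,2,5,8,7,6,1,3]], [[0,4,1,5,8,7,6,2,3]], [[1,4,2,5,8,7,6,0,3]]],
    [
    [[2,0,5,3,1,7,8,6,4]], [[1,0,5,3,2,7,8,6,4]], [[2,0,4,3,1,6,8,7,5]], [[0,1,3,5,7,2,6,8,4]],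
    [[0,2,3,5,7,1,6,8,4]], [[0,2,3,4,6,1,7,8,5]], [[2,0,1,5,7,6,3,8,4]], [[3,1,0,5,7,6,2,8,4]],
    [[2,0,1,4,6,7,3,8,5], [3,1,0,5,7,6,2,8,4]], [[0,2,5,1,6,7,8,3,4]],
    [[0,2,4,1,7,6,8,3,5], [1,3,5,0,6,7,8,2,4]], [[1,3,5,0,6,7,8,2,4]]],
    [
    [[5,4,3,1,2,8,7,6,0], [5,4,3,2,1,8,7,6,0]], [[5,2,4,1,0,7,8,6,3]], [[5,2,3,4,0,7,8,6,1]],
    [[3,2,4,5,7,1,6,8,0]], [[2,3,4,5,7,0,6,8,1]], [[1,2,4,5,7,0,6,8,3]],
    [[1,4,0,5,7,6,3,8,2], [2,4,0,5,7,6,3,8,1]], [[0,4,2,5,7,6,1,8,3]], [[1,4,2,5,7,6,0,8,3]],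
    [[5,2,4,0,6,8,7,1,3]], [[5,2,4,0,6,7,8,1,3]], [[5,2,4,0,6,7,8,1,3]]],
    [
    [[2,5,6,3,1,4,7,8,0]], [[2,4,6,5,1,0,7,8,3]], [[1,5,6,3,2,0,7,8,4]], [[1,6,4,5,2,7,3,8,0]],
    [[1,6,4,5,2,7,0,8,3]], [[0,6,4,5,2,7,1,8,3]], [[0,1,3,5,2,7,6,4,8], [0,1,4,5,2,7,6,3,8]],
    [[1,0,5,4,3,6,7,2,8]], [[2,5,3,0,4,7,6,8,1]], [[2,3,5,0,4,6,7,1,8]],
    [[0,4,1,3,2,6,7,8,5], [0,5,1,3,2,6,7,8,4]], [[0,5,1,4,2,7,6,8,3], [1,4,0,5,3,8,6,7,2]],
    [[3,1,0,5,4,7,6,2,8]], [[1,4,5,0,3,6,7,8,2]], [[0,5,4,1,2,7,6,8,3]], [[0,4,3,2,1,7,6,8,5]]],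
    [
    [[4,6,3,2,5,1,7,8,0]], [[4,6,3,2,5,0,7,8,1]], [[4,6,3,2,5,1,7,8,0]], [[6,3,5,1,4,7,2,8,0]],
    [[6,3,5,1,4,7,0,8,2]], [[5,2,4,1,6,7,0,8,3], [6,3,4,1,5,7,0,8,2]],
    [[0,1,3,4,5,6,8,2,7], [0,2,3,4,5,6,8,1,7]], [[0,3,4,5,2,6,8,1,7]], [[4,2,1,3,5,6,8,7,0]],
    [[2,4,1,3,5,6,8,0,7]], [[2,0,5,4,3,6,7,8,1]], [[2,0,4,3,5,8,6,7,1]],
    [[0,1,4,3,5,6,7,2,8], [0,2,3,4,5,6,8,1,7]], [[4,5,0,2,3,6,8,7,1]], [[3,4,0,1,5,6,7,8,2]],
    [[0,1,2,3,5,7,8,6,4], [5,4,3,2,0,7,6,8,1]]],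
    [
    [[2,5,4,3,1,7,6,8,0]], [[1,4,5,3,0,6,7,8,2], [2,5,4,3,0,7,6,8,1]], [[2,5,3,4,0,6,7,8,1]],
    [[2,5,3,4,7,1,8,6,0]], [[2,5,4,3,6,0,8,7,1]], [[1,4,3,5,6,0,8,7,2], [2,5,3,4,7,0,8,6,1]],
    [[4,2,5,3,6,8,0,7,1]], [[3,1,5,4,6,8,0,7,2], [4,2,5,3,6,8,0,7,1]], [[4,1,5,3,6,8,0,7,2]],
    [[4,2,3,5,8,6,7,0,1]], [[3,1,4,5,8,6,7,0,2], [4,2,3,5,8,6,7,0,1]], [[4,1,3,5,8,6,7,0,2]]],
    [
    [[0,1,3,2,5,8,7,6,4]], [[3,1,0,5,2,6,7,8,4], [2,4,5,0,3,6,8,7,1]], [[4,3,1,2,0,6,7,8,5]],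
    [[0,1,3,2,8,5,7,6,4]], [[3,1,0,5,6,2,7,8,4], [2,4,5,0,6,3,8,7,1]], [[4,3,1,2,6,0,7,8,5]],
    [[1,0,3,4,6,7,2,8,5], [2,0,3,5,7,6,1,8,4]], [[2,0,3,4,7,6,1,8,5]], [[2,0,3,4,6,7,1,8,5]],
    [[0,1,4,3,6,7,8,2,5], [0,2,5,3,7,6,8,1,4]], [[0,2,4,3,7,6,8,1,5]], [[0,2,4,3,6,7,8,1,5]]],
    [
    [[1,4,6,3,5,2,7,8,0]], [[1,4,6,3,5,0,7,8,2]], [[1,4,6,3,5,0,7,8,2]], [[1,6,4,5,2,7,3,8,0]],
    [[1,6,4,5,3,7,0,8,2]], [[1,6,3,5,2,7,0,8,4]], [[0,1,4,2,3,7,8,5,6], [0,1,5,2,3,7,8,4,6]],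
    [[3,2,5,4,1,6,8,0,7]], [[2,4,3,0,5,6,8,7,1]], [[2,3,5,0,4,6,8,1,7]], [[2,5,3,4,1,7,8,6,0]],
    [[0,4,1,2,3,7,8,6,5], [1,3,0,5,4,8,7,6,2]], [[3,0,2,4,5,6,8,1,7]], [[1,4,5,0,3,6,8,7,2]],
    [[0,4,5,1,2,7,8,6,3]], [[0,4,5,2,1,7,8,6,3]]],
    [
    [[3,5,2,6,0,4,7,8,1]], [[6,5,1,3,2,0,7,8,4]], [[4,5,2,3,1,0,7,8,6]], [[5,4,0,6,2,7,3,8,1]],
    [[5,3,0,6,2,7,1,8,4]], [[4,3,1,6,2,7,0,8,5]], [[0,1,2,5,4,8,7,3,6]], [[0,1,2,5,4,7,8,3,6]],
    [[3,0,2,4,5,8,7,6,1]], [[0,1,3,4,5,8,7,2,6]], [[1,0,2,4,5,7,8,6,3]],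
    [[1,0,2,5,4,8,7,6,3], [2,0,1,4,5,8,6,7,3]], [[1,0,3,5,4,8,7,2,6]], [[2,0,1,3,5,7,8,6,4]],
    [[2,0,1,3,5,8,7,6,4]], [[1,0,2,3,4,8,7,6,5]]],
    [
    [[2,0,5,4,6,3,7,8,1]], [[2,0,5,4,6,1,7,8,3]], [[2,0,5,3,6,1,7,8,4]], [[0,2,4,5,6,7,3,8,1]],
    [[0,2,4,5,6,7,1,8,3]], [[0,2,3,5,6,7,1,8,4]], [[2,0,1,4,5,7,6,3,8]],
    [[1,0,2,3,5,6,7,4,8], [2,0,1,4,5,6,7,3,8]], [[0,2,5,1,4,6,7,8,3]], [[2,0,1,5,4,7,6,3,8]],
    [[0,2,4,1,5,6,7,8,3]], [[0,1,3,2,5,7,6,8,4], [0,2,4,1,5,7,6,8,3]], [[0,1,3,2,5,7,6,4,8]],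
    [[1,0,3,2,4,6,7,8,5]], [[0,1,2,3,4,7,6,8,5]], [[0,1,3,2,4,7,6,8,5], [1,0,2,3,5,6,7,8,4]]],
    [
    [[5,2,3,4,1,7,6,8,0]], [[5,2,4,3,0,7,6,8,1]], [[4,1,3,5,0,7,6,8,2], [5,2,3,4,0,7,6,8,1]],
    [[2,5,4,3,7,1,8,6,0]], [[1,4,5,3,7,0,8,6,2], [2,5,4,3,7,0,8,6,1]], [[2,5,3,4,7,0,8,6,1]],
    [[4,2,3,5,6,8,0,7,1]], [[4,1,3,5,6,8,0,7,2]], [[4,1,2,5,6,7,0,8,3], [4,1,3,5,6,8,0,7,2]],
    [[2,4,5,3,8,6,7,0,1]], [[1,4,5,3,8,6,7,0,2]], [[1,4,5,2,7,6,8,0,3], [1,4,5,3,8,6,7,0,2]]],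
    [
    [[4,2,3,5,0,7,6,8,1]], [[4,2,3,5,0,6,7,8,1]], [[3,1,2,5,0,7,6,8,4]],
    [[2,4,0,5,6,1,8,7,3], [3,5,1,4,7,0,8,6,2]], [[2,4,0,5,6,1,8,7,3]], [[2,5,1,4,6,0,8,7,3]],
    [[2,0,4,5,6,8,1,7,3], [3,1,5,4,7,8,0,6,2]], [[2,0,4,5,6,8,1,7,3]], [[2,1,5,4,6,8,0,7,3]],
    [[0,3,4,5,8,7,6,1,2]], [[0,4,3,5,8,6,7,1,2]], [[1,4,5,2,8,7,6,0,3], [1,5,4,3,8,6,7,0,2]]],
    [
    [[5,7,3,0,6,4,2,8,1]], [[4,6,2,0,7,3,1,8,5]], [[2,6,3,0,4,7,1,8,5], [5,7,4,1,3,6,0,8,2]],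
    [[0,2,3,1,5,6,7,4,8]], [[0,4,5,1,6,2,7,3,8]], [[1,3,2,0,4,5,7,8,6]],
    [[0,3,5,1,2,6,7,4,8], [0,4,5,1,2,6,7,3,8]], [[1,3,2,0,5,4,7,8,6]],
    [[0,2,3,1,4,5,7,6,8], [1,3,2,0,5,4,6,7,8]], [[4,1,0,2,6,5,7,8,3]], [[0,4,1,2,6,5,7,3,8]],
    [[1,2,3,0,4,5,6,8,7]], [[1,3,2,0,5,4,7,6,8]], [[4,0,5,2,1,6,7,8,3]], [[1,3,2,0,4,5,7,6,8]],
    [[3,0,5,1,6,2,7,8,4], [4,0,5,2,6,1,7,8,3]], [[2,0,3,1,4,6,7,8,5], [2,0,3,1,5,6,7,8,4]],
    [[0,1,4,2,5,6,7,3,8]], [[1,3,2,0,5,4,6,8,7]], [[0,2,3,1,5,4,7,6,8]], [[4,5,0,1,2,6,7,8,3]],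
    [[0,2,3,1,4,5,7,6,8]], [[4,5,0,2,6,1,7,8,3]], [[2,3,0,1,6,4,7,8,5], [2,3,0,1,6,5,7,8,4]],
    [[0,2,3,1,4,5,7,6,8]], [[5,6,3,1,2,0,7,8,4]], [[2,3,4,0,1,6,7,8,5]], [[3,4,2,0,6,1,7,8,5]]],
    [
    [[5,2,4,3,1,7,8,6,0]], [[4,2,5,3,0,7,8,6,1]], [[5,2,3,4,0,7,8,6,1]], [[2,5,3,4,7,1,6,8,0]],
    [[2,5,4,3,7,0,6,8,1]], [[2,4,3,5,7,0,6,8,1]], [[4,2,3,5,8,6,0,7,1]], [[3,1,4,5,7,6,0,8,2]],
    [[4,1,2,5,7,6,0,8,3]], [[2,4,5,3,6,8,7,0,1]], [[1,3,5,4,6,7,8,0,2]], [[1,4,5,2,6,7,8,0,3]]],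
    [
    [[2,0,3,1,6,5,4,8,7]], [[3,0,4,2,6,5,1,8,7]], [[3,2,5,0,4,6,7,8,1]], [[3,0,4,2,5,6,1,8,7]],
    [[4,2,5,0,6,3,7,8,1]], [[2,1,3,0,6,4,7,8,5], [2,1,3,0,6,5,7,8,4]], [[3,0,4,1,6,5,2,8,7]],
    [[3,1,5,0,6,4,7,8,2]], [[2,0,3,1,4,5,7,8,6]], [[2,0,3,1,5,4,7,8,6], [2,1,4,0,6,3,7,8,5]],
    [[0,2,1,3,5,6,8,4,7]], [[0,3,2,4,6,5,8,1,7]], [[2,4,0,5,3,6,8,7,1]], [[0,3,2,4,5,6,8,1,7]],
    [[2,3,0,5,6,4,8,7,1]], [[1,2,0,3,4,6,8,7,5], [1,2,0,3,5,6,8,7,4]], [[0,3,1,4,5,6,8,2,7]],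
    [[1,3,0,5,4,6,8,7,2]], [[0,2,1,3,4,5,8,7,6], [1,2,0,4,3,6,8,7,5]], [[0,2,1,3,5,4,8,7,6]]],
    [
    [[0,1,4,3,6,5,7,8,2]], [[0,1,4,3,6,2,7,8,5]], [[0,2,4,3,5,1,7,8,6]], [[0,1,6,5,3,7,4,8,2]],
    [[1,0,5,6,3,7,2,8,4]], [[1,0,4,5,3,7,2,8,6], [2,0,4,6,3,7,1,8,5]], [[0,1,2,4,3,8,6,5,7]],
    [[0,1,2,3,4,6,8,5,7]], [[0,3,5,2,1,7,6,8,4]], [[0,1,3,5,2,7,6,4,8]], [[0,2,5,1,3,6,8,7,4]],
    [[0,1,5,2,3,8,6,7,4]], [[0,2,3,1,5,6,7,4,8]], [[0,1,4,3,2,6,8,7,5], [0,2,5,3,1,7,8,6,4]],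
    [[0,2,5,3,1,8,6,7,4]], [[0,1,4,3,2,8,7,6,5]]],
    [
    [[5,2,0,3,6,4,7,8,1], [5,2,0,4,6,3,7,8,1]], [[3,2,0,4,6,1,7,8,5]], [[4,2,0,3,6,1,7,8,5]],
    [[5,0,2,6,3,7,4,8,1], [5,0,2,6,4,7,3,8,1]], [[3,0,2,6,4,7,1,8,5]], [[4,0,2,6,3,7,1,8,5]],
    [[0,1,2,5,4,8,6,3,7]], [[0,2,1,4,5,6,8,3,7]], [[2,0,4,5,1,8,6,7,3], [3,1,5,4,0,8,6,7,2]],
    [[0,1,3,5,4,8,6,2,7]], [[1,3,0,2,5,6,8,7,4]], [[0,2,1,3,4,8,7,6,5]], [[0,3,1,4,5,6,8,2,7]],
    [[0,1,2,4,3,7,8,6,5]], [[1,0,3,5,2,8,6,7,4]], [[0,1,2,4,3,8,7,6,5]]],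
    [
    [[3,1,4,5,2,7,6,8,0], [3,2,4,5,1,7,6,8,0]], [[2,3,4,5,0,7,6,8,1]], [[2,1,4,5,0,7,6,8,3]],
    [[2,5,3,4,7,1,8,6,0]], [[2,5,4,3,7,0,8,6,1]], [[1,4,3,5,6,0,8,7,2], [2,5,3,4,7,0,8,6,1]],
    [[3,1,5,4,6,8,0,7,2]], [[3,1,5,4,6,8,0,7,2]], [[4,1,5,3,6,8,0,7,2]], [[4,5,3,2,8,6,7,1,0]],
    [[4,5,2,3,8,6,7,0,1]], [[4,5,3,1,8,6,7,0,2], [4,5,3,2,8,6,7,0,1]]],
    [
    [[0,2,1,4,6,3,5,8,7], [0,2,1,5,6,3,4,8,7]], [[1,4,0,5,6,3,2,8,7]], [[0,3,1,4,5,6,7,8,2]],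
    [[1,3,0,5,4,6,2,8,7]], [[0,4,1,5,6,3,7,8,2]], [[0,2,1,3,5,4,7,8,6]], [[1,4,0,3,6,5,2,8,7]],
    [[0,4,1,6,5,3,7,8,2]], [[0,2,1,5,3,4,7,8,6]], [[0,2,1,4,5,3,7,8,6], [0,3,1,4,6,2,7,8,5]],
    [[0,1,2,6,4,3,8,5,7], [0,1,2,6,5,3,8,4,7]], [[1,0,4,6,5,3,8,2,7]], [[0,1,3,5,4,6,8,7,2]],
    [[1,0,4,6,3,5,8,2,7]], [[0,1,4,5,6,3,8,7,2]], [[0,1,2,3,5,4,8,7,6]], [[1,0,3,4,5,6,8,2,7]],
    [[0,1,4,6,5,3,8,7,2]], [[0,1,2,5,3,4,8,7,6]], [[0,1,2,5,4,3,8,7,6], [0,1,3,6,4,2,8,7,5]]],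
    [
    [[3,4,1,5,2,8,6,7,0]], [[3,1,4,5,0,7,6,8,2]], [[4,2,1,5,0,7,6,8,3]], [[2,0,4,5,7,1,6,8,3]],
    [[2,0,4,5,7,1,6,8,3]], [[2,1,5,3,6,0,7,8,4]], [[0,4,1,5,6,7,2,8,3]], [[0,4,1,5,6,7,2,8,3]],
    [[0,3,2,5,6,7,1,8,4]], [[0,3,2,4,6,8,7,1,5], [0,3,2,5,6,8,7,1,4]],
    [[0,3,2,5,6,8,7,1,4], [1,4,5,2,6,7,8,0,3]], [[1,4,3,2,6,8,7,0,5]]],
    [
    [[0,1,3,2,6,5,4,8,7]], [[0,2,5,3,6,4,1,8,7]], [[2,0,3,5,4,6,7,8,1]], [[0,1,4,3,5,6,2,8,7]],
    [[1,0,3,4,6,5,7,8,2]], [[1,0,2,3,5,6,7,8,4]], [[0,1,4,3,6,5,2,8,7]], [[0,1,4,3,6,5,7,8,2]],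
    [[1,0,2,3,4,5,7,8,6]], [[0,1,3,2,5,4,7,8,6]], [[3,2,0,1,4,6,8,5,7], [3,2,0,1,5,6,8,4,7]],
    [[5,3,0,2,6,4,8,1,7]], [[3,5,2,0,4,6,8,7,1]], [[5,4,0,2,3,6,8,1,7]], [[4,5,2,0,6,3,8,7,1]],
    [[2,3,1,0,6,4,8,7,5], [2,3,1,0,6,5,8,7,4]], [[4,3,0,1,5,6,8,2,7]], [[6,5,1,2,3,4,8,7,0]],
    [[3,2,0,1,4,5,8,7,6]], [[2,3,1,0,5,4,8,7,6]]],
    [
    [[0,4,3,5,2,8,7,6,1], [1,5,2,4,3,8,6,7,0]], [[0,4,2,5,1,8,6,7,3]], [[1,4,2,5,0,8,6,7,3]],
    [[2,0,4,5,6,1,7,8,3], [3,1,5,4,7,0,6,8,2]], [[2,1,4,5,7,0,6,8,3]], [[2,1,5,3,6,0,7,8,4]],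
    [[2,5,0,4,6,7,1,8,3]], [[2,5,0,4,6,7,1,8,3]], [[2,5,1,3,6,7,0,8,4]], [[1,0,3,5,6,7,8,2,4]],
    [[1,0,3,5,6,7,8,2,4]], [[1,0,3,5,6,7,8,2,4]]],
    [
    [[4,0,3,6,5,2,7,8,1]], [[4,1,3,6,5,0,7,8,2]], [[4,1,3,6,5,0,7,8,2]],
    [[2,0,5,4,6,7,3,8,1], [3,1,6,4,5,7,2,8,0]], [[3,1,5,2,6,7,0,8,4]],
    [[3,1,6,2,4,7,0,8,5], [3,1,6,2,5,7,0,8,4]], [[0,1,4,2,5,7,8,3,6], [0,1,4,3,5,7,8,2,6]],
    [[0,1,4,3,5,7,8,2,6]], [[2,0,1,4,5,6,8,7,3]], [[0,3,4,2,5,7,8,1,6]], [[3,1,0,5,4,6,8,7,2]],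
    [[1,0,2,3,5,7,8,6,4]], [[0,1,3,4,5,6,8,2,7]], [[0,2,4,1,5,7,8,6,3]], [[0,1,3,2,5,7,8,6,4]],
    [[0,1,3,2,5,7,8,6,4]]]]"

lemma gamma7_scaled_valid:
  "list_all (\<lambda>(c, ps). valid_pairs 8 ps \<and>
     list_all (\<lambda>v. 3 \<le> length (incident_list ps v)) [0..<8]) gamma7_scaled"
  by code_simp

text \<open>The test of the coefficients against each other: splittings with equal canonical form
  are merged on insertion, and every merged integer coefficient must be zero.\<close>

lemma gamma7_splits_cancel: "all_zero (add_graphs 8 gamma7_scaled split_relabellings Leaf)"
  by code_simp

text \<open>The least common denominator of the coefficients is 16, so the evaluation can stay
  within the integers.\<close>

lemma gamma7_eq:
  "gamma7 = (\<lambda>H. \<Sum>(c, G)\<leftarrow>map (\<lambda>(c, ps). (of_int c / 16, pair_graph 8 ps)) gamma7_scaled. c * ind G H)"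
proof -
  have eq: "map (\<lambda>(es, c). (c, gr8 es)) gamma7_terms =
      map (\<lambda>(c, ps). (of_int c / 16, pair_graph 8 ps)) gamma7_scaled"
    by (simp add: gamma7_terms_def gamma7_scaled_def gr8_def dec_edge_def pair_graph_def)
  show ?thesis
    unfolding eq[symmetric] gamma7_def by (simp add: comp_def case_prod_unfold)
qed

lemma dgc_gamma7: "dgc gamma7 \<in> rel"
proof -
  have valid: "valid_pairs 8 ps" "\<And>v. v < 8 \<Longrightarrow> 3 \<le> length (incident_list ps v)"
    if "(c, ps) \<in> set gamma7_scaled" for c ps
    using that gamma7_scaled_valid by (auto simp: list_all_iff)
  let ?Z = "\<lambda>H. \<Sum>(c, ps)\<leftarrow>gamma7_scaled. of_int c * (\<Sum>qs\<leftarrow>all_splits 8 ps. ind (pair_graph (Suc 8) qs) H)"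
  have d: "dgc gamma7 = (\<lambda>H. \<Sum>(c, ps)\<leftarrow>gamma7_scaled. of_int c / 16 * d_graph (pair_graph 8 ps) H)"
    unfolding gamma7_eq dgc_sum_list by (simp add: comp_def case_prod_unfold)
  have half: "eqv (\<lambda>H. \<Sum>(c, ps)\<leftarrow>gamma7_scaled. of_int c / 16 * d_graph (pair_graph 8 ps) H)
      (\<lambda>H. \<Sum>(c, ps)\<leftarrow>gamma7_scaled. of_int c / 16 *
        (2 * (\<Sum>qs\<leftarrow>all_splits 8 ps. ind (pair_graph (Suc 8) qs) H)))"
    using valid unfolding case_prod_unfold by (intro eqv_sum_list eqv_smult eqv_d_pair_graph) auto
  \<comment> \<open>The factor 2 of the splitting formula and the denominator 16 combine to
    1/8.\<close>
  have Z: "(\<lambda>H. \<Sum>(c, ps)\<leftarrow>gamma7_scaled. of_int c / 16 *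
        (2 * (\<Sum>qs\<leftarrow>all_splits 8 ps. ind (pair_graph (Suc 8) qs) H))) = (\<lambda>H. 1 / 8 * ?Z H)"
    by (simp add: sum_list_const_mult[symmetric] case_prod_unfold)
  have "eqv (\<lambda>H. ?Z H + chain_of (Suc 8) Leaf H) (chain_of (Suc 8) (add_graphs 8 gamma7_scaled split_relabellings Leaf))"
    using valid by (intro chain_of_add_graphs)
  then have "eqv ?Z (\<lambda>_. 0)"
    by (simp add: chain_of_all_zero[OF gamma7_splits_cancel])
  from eqv_trans[OF half[unfolded Z] eqv_smult[OF this]] show ?thesis
    unfolding d by (simp add: eqv_def)
qed

section \<open>Counting copies of a graph with sign\<close>

lemma iso_signE:
  assumes "iso_sign (n, es) (n', es') s"
  obtains \<pi> p where "n' = n" "length es' = length es" "\<pi> permutes {0..<n}" "p permutes {0..<length es}"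
    "\<And>i. i < length es \<Longrightarrow> es' ! p i = \<pi> ` (es ! i)" "s = sign p"
  using assms unfolding iso_sign_def by auto

lemma iso_sign_refl: "iso_sign G G 1"
proof -
  have "iso_sign (fst G, snd G) (fst G, snd G) (sign (id :: nat \<Rightarrow> nat))"
    by (rule iso_signI[where \<pi> = id]) (simp_all add: permutes_id)
  then show ?thesis by simp
qed

lemma iso_sign_sym:
  assumes "iso_sign G G' s"
  shows "iso_sign G' G s"
proof -
  obtain n es n' es' where G: "G = (n, es)" "G' = (n', es')" by (cases G, cases G')
  obtain \<pi> p where n: "n' = n" "length es' = length es" and \<pi>: "\<pi> permutes {0..<n}"
    and p: "p permutes {0..<length es}" and e: "\<And>i. i < length es \<Longrightarrow> es' ! p i = \<pi> ` (es ! i)" and s: "s = sign p"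
    using iso_signE[OF assms[unfolded G]] by blast
  have "iso_sign (n, es') (n, es) (sign (inv p))"
  proof (rule iso_signI)
    show "inv \<pi> permutes {0..<n}" "inv p permutes {0..<length es'}" "length es = length es'"
      using \<pi> p n by (simp_all add: permutes_inv)
    fix i assume "i < length es'"
    then have "inv p i < length es" using permutes_in_image[OF permutes_inv[OF p], of i] n by simp
    from e[OF this] have "es' ! i = \<pi> ` (es ! inv p i)" by (simp add: permutes_inverses[OF p])
    then show "es ! inv p i = inv \<pi> ` (es' ! i)"
      by (simp add: image_comp comp_def permutes_inverses[OF \<pi>])
  qed
  moreover have "sign (inv p) = s"
    using p s by (simp add: sign_inverse permutes_imp_permutation[OF _ p])
  ultimately show ?thesis by (simp add: G n)
qed

lemma iso_sign_trans:
  assumes "iso_sign G G' s" "iso_sign G' G'' t"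
  shows "iso_sign G G'' (s * t)"
proof -
  obtain n es n' es' n'' es'' where G: "G = (n, es)" "G' = (n', es')" "G'' = (n'', es'')"
    by (cases G, cases G', cases G'')
  obtain \<pi> p where n: "n' = n" "length es' = length es" and \<pi>: "\<pi> permutes {0..<n}"
    and p: "p permutes {0..<length es}" and e: "\<And>i. i < length es \<Longrightarrow> es' ! p i = \<pi> ` (es ! i)" and s: "s = sign p"
    using iso_signE[OF assms(1)[unfolded G]] by blast
  obtain \<rho> q where n': "n'' = n'" "length es'' = length es'" and \<rho>: "\<rho> permutes {0..<n'}"
    and q: "q permutes {0..<length es'}" and e': "\<And>i. i < length es' \<Longrightarrow> es'' ! q i = \<rho> ` (es' ! i)" and t: "t = sign q"
    using iso_signE[OF assms(2)[unfolded G]] by blast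
  have "iso_sign (n, es) (n, es'') (sign (q \<circ> p))"
  proof (rule iso_signI)
    show "\<rho> \<circ> \<pi> permutes {0..<n}" "q \<circ> p permutes {0..<length es}" "length es'' = length es"
      using \<pi> \<rho> p q n n' by (simp_all add: permutes_compose)
    fix i assume i: "i < length es"
    then have "p i < length es'" using permutes_in_image[OF p, of i] n by simp
    then show "es'' ! (q \<circ> p) i = (\<rho> \<circ> \<pi>) ` (es ! i)"
      using e[OF i] e' by (simp add: image_comp)
  qed
  moreover have "sign (q \<circ> p) = s * t"
    using sign_compose[OF permutes_imp_permutation[OF _ q] permutes_imp_permutation[OF _ p]] s t by simp
  ultimately show ?thesis by (simp add: G n n')
qed

lemma iso_sign_cases: "iso_sign G G' s \<Longrightarrow> s = 1 \<or> s = - 1"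
  by (auto simp: iso_sign_def intro: sign_cases)

text \<open>The equivalence is stated for arbitrary sets \<open>e\<close>, so that absent edges can
  be transported too.\<close>

lemma iso_sign_edges:
  assumes "iso_sign G G' s"
  obtains \<pi> where "\<pi> permutes {0..<fst G}" "fst G' = fst G" "\<And>e. \<pi> ` e \<in> set (snd G') \<longleftrightarrow> e \<in> set (snd G)"
proof -
  obtain n es n' es' where G: "G = (n, es)" "G' = (n', es')" by (cases G, cases G')
  obtain \<pi> p where n: "n' = n" "length es' = length es" and \<pi>: "\<pi> permutes {0..<n}"
    and p: "p permutes {0..<length es}" and e: "\<And>i. i < length es \<Longrightarrow> es' ! p i = \<pi> ` (es ! i)" and "s = sign p"
    using iso_signE[OF assms[unfolded G]] by blast
  have "set es' = (`) \<pi> ` set es"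
  proof -
    have nth: "(!) xs ` {0..<length xs} = set xs" for xs :: "nat set list"
      by (metis map_nth set_map set_upt)
    have "set es' = (!) es' ` p ` {0..<length es}"
      using nth[of es'] by (simp only: n permutes_image[OF p])
    also have "\<dots> = (\<lambda>i. es' ! p i) ` {0..<length es}"
      by (rule image_image)
    also have "\<dots> = (\<lambda>i. \<pi> ` (es ! i)) ` {0..<length es}"
      using e by (intro image_cong) auto
    also have "\<dots> = (`) \<pi> ` set es"
      unfolding nth[of es, symmetric] image_image ..
    finally show ?thesis .
  qed
  then have "\<pi> ` e \<in> set es' \<longleftrightarrow> e \<in> set es" for e
    by (simp add: image_iff inj_image_eq_iff[OF permutes_inj[OF \<pi>]])
  then show ?thesis using that[of \<pi>] \<pi> n by (simp add: G)
qed

section \<open>The signed count as a linear functional\<close>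

definition iso_weight :: "graph \<Rightarrow> graph \<Rightarrow> real" where
  "iso_weight W G = of_bool (iso_sign G W 1) - of_bool (iso_sign G W (- 1))"

text \<open>The sum runs over the isomorphism class of \<open>W\<close>, not over the support of
  \<open>c\<close>; the index set is thus the same for all chains, and linearity is
  immediate.\<close>

definition wcoeff :: "graph \<Rightarrow> chain \<Rightarrow> real" where
  "wcoeff W c = (\<Sum>G | isomorphic G W. iso_weight W G * c G)"

lemma iso_weight_zero: "\<not> isomorphic G W \<Longrightarrow> iso_weight W G = 0"
  by (auto simp: iso_weight_def isomorphic_def)

text \<open>Composition with the given isomorphism multiplies all signs by \<open>s\<close>, so it
  either keeps or exchanges the two terms of the weight.\<close>

lemma iso_weight_iso:
  assumes "iso_sign G G' s"
  shows "iso_weight W G = of_int s * iso_weight W G'"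
proof -
  have "iso_sign G W t \<longleftrightarrow> iso_sign G' W (s * t)" for t
  proof
    assume "iso_sign G W t"
    then show "iso_sign G' W (s * t)" using iso_sign_trans[OF iso_sign_sym[OF assms]] by blast
  next
    assume "iso_sign G' W (s * t)"
    from iso_sign_trans[OF assms this] show "iso_sign G W t"
      using iso_sign_cases[OF assms] by auto
  qed
  then show ?thesis using iso_sign_cases[OF assms] by (auto simp: iso_weight_def)
qed

text \<open>Vertex labels are bounded by \<open>n\<close>, so only finitely many edge lists of the
  given length are possible.\<close>

lemma finite_isomorphic:
  assumes "wf_graph W"
  shows "finite {G. isomorphic G W}"
proof -
  obtain n es where W: "W = (n, es)" by (cases W)
  have "{G. isomorphic G W} \<subseteq> {n} \<times> {xs. set xs \<subseteq> Pow {0..<n} \<and> length xs = length es}"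
  proof
    fix G assume "G \<in> {G. isomorphic G W}"
    moreover obtain m xs where G: "G = (m, xs)" by (cases G)
    ultimately obtain s where iso: "iso_sign (m, xs) (n, es) s" by (auto simp: isomorphic_def W)
    then have "m = n" "length xs = length es" by (auto simp: iso_sign_def)
    moreover have "e \<subseteq> {0..<n}" if "e \<in> set xs" for e
    proof -
      obtain \<pi> where \<pi>: "\<pi> permutes {0..<m}" "\<And>e. \<pi> ` e \<in> set es \<longleftrightarrow> e \<in> set xs"
        using iso_sign_edges[OF iso] by auto
      then have "\<pi> ` e \<in> set es" using that by simp
      then obtain a b where "\<pi> ` e = {a, b}" "a < n" "b < n"
        by (rule wf_graph_edgeE[OF assms[unfolded W]])
      then have "\<pi> x \<in> {0..<n}" if "x \<in> e" for x using that by fastforce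
      then show ?thesis using permutes_in_image[OF \<pi>(1)] \<open>m = n\<close> by blast
    qed
    ultimately show "G \<in> {n} \<times> {xs. set xs \<subseteq> Pow {0..<n} \<and> length xs = length es}" by (auto simp: G)
  qed
  moreover have "finite ({n} \<times> {xs. set xs \<subseteq> Pow {0..<n} \<and> length xs = length es})"
    by (intro finite_SigmaI finite_lists_length_eq) auto
  ultimately show ?thesis by (rule finite_subset)
qed

lemma wcoeff_add: "wcoeff W (\<lambda>H. a H + b H) = wcoeff W a + wcoeff W b"
  by (simp add: wcoeff_def sum.distrib distrib_left)

lemma wcoeff_smult: "wcoeff W (\<lambda>H. r * a H) = r * wcoeff W a"
  by (simp add: wcoeff_def sum_distrib_left mult.left_commute)

lemma wcoeff_zero: "wcoeff W (\<lambda>_. 0) = 0"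
  by (simp add: wcoeff_def)

lemma wcoeff_diff: "wcoeff W (\<lambda>H. a H - b H) = wcoeff W a - wcoeff W b"
  using wcoeff_add[of W a "\<lambda>H. - 1 * b H"] wcoeff_smult[of W "- 1" b] by simp

lemma wcoeff_sum: "wcoeff W (\<lambda>H. \<Sum>i\<in>I. f i H) = (\<Sum>i\<in>I. wcoeff W (f i))"
  by (induction I rule: infinite_finite_induct) (simp_all add: wcoeff_zero wcoeff_add)

lemma wcoeff_ind:
  assumes "wf_graph W"
  shows "wcoeff W (ind G) = iso_weight W G"
proof (cases "isomorphic G W")
  case True
  then show ?thesis
    using finite_isomorphic[OF assms] by (simp add: wcoeff_def ind_def if_distrib cong: if_cong)
next
  case False
  then have "wcoeff W (ind G) = 0" by (auto simp: wcoeff_def ind_def intro!: sum.neutral)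
  then show ?thesis using iso_weight_zero[OF False] by simp
qed

lemma wcoeff_rel:
  assumes "wf_graph W" "c \<in> rel"
  shows "wcoeff W c = 0"
  using assms(2)
proof (induction rule: rel.induct)
  case (rel_gen G G' s)
  then show ?case
    using iso_weight_iso[of G G' s W] by (simp add: wcoeff_diff wcoeff_smult wcoeff_ind[OF assms(1)])
qed (simp_all add: wcoeff_zero wcoeff_add wcoeff_smult)

lemma wcoeff_eqv: "wf_graph W \<Longrightarrow> eqv a b \<Longrightarrow> wcoeff W a = wcoeff W b"
  using wcoeff_rel[of W "\<lambda>H. a H - b H"] by (simp add: eqv_def wcoeff_diff)

section \<open>Triangles and the terms of a differential\<close>

definition triangulated :: "graph \<Rightarrow> bool" where
  "triangulated G \<longleftrightarrow> (\<forall>a b. {a, b} \<in> set (snd G) \<longrightarrow>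
     (\<exists>c. c \<noteq> a \<and> c \<noteq> b \<and> {a, c} \<in> set (snd G) \<and> {b, c} \<in> set (snd G)))"

lemma triangulated_iso:
  assumes "iso_sign G G' s" "triangulated G'"
  shows "triangulated G"
  unfolding triangulated_def
proof (intro allI impI)
  fix a b assume ab: "{a, b} \<in> set (snd G)"
  obtain \<pi> where \<pi>: "\<pi> permutes {0..<fst G}" and e: "\<And>e. \<pi> ` e \<in> set (snd G') \<longleftrightarrow> e \<in> set (snd G)"
    using iso_sign_edges[OF assms(1)] by blast
  from ab have "{\<pi> a, \<pi> b} \<in> set (snd G')" using e[of "{a, b}"] by simp
  then obtain d where "d \<noteq> \<pi> a" "d \<noteq> \<pi> b" "{\<pi> a, d} \<in> set (snd G')" "{\<pi> b, d} \<in> set (snd G')"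
    using assms(2) unfolding triangulated_def by blast
  moreover define c where "c = inv \<pi> d"
  moreover have "\<pi> c = d" by (simp add: c_def permutes_inverses[OF \<pi>])
  ultimately show "\<exists>c. c \<noteq> a \<and> c \<noteq> b \<and> {a, c} \<in> set (snd G) \<and> {b, c} \<in> set (snd G)"
    using e[of "{a, c}"] e[of "{b, c}"] by (intro exI[of _ c]) auto
qed

text \<open>A vertex \<open>c\<close> adjacent to both ends of the new edge would come from two
  edges of the original graph between \<open>v\<close> and \<open>c\<close>, one moved and one kept;
  but there are no multiple edges.\<close>

lemma not_triangulated_split:
  assumes wf: "wf_graph (n, es)" and v: "v < n" and S: "S \<subseteq> incident es v"
  shows "\<not> triangulated (split_graph (n, es) v S)"
proof
  let ?m = "\<lambda>k. if k \<in> S then insert n (es ! k - {v}) else es ! k"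
  have edges: "set (snd (split_graph (n, es) v S)) = insert {v, n} (?m ` {0..<length es})"
    by (simp add: split_graph_Pair)
  assume "triangulated (split_graph (n, es) v S)"
  from this[unfolded triangulated_def edges, rule_format, of v n]
  obtain c where c: "c \<noteq> v" "c \<noteq> n" "{v, c} \<in> insert {v, n} (?m ` {0..<length es})"
    "{n, c} \<in> insert {v, n} (?m ` {0..<length es})"
    by auto
  have "{v, c} \<noteq> {v, n}" "{n, c} \<noteq> {v, n}" using c(1,2) by (auto simp: doubleton_eq_iff)
  then have "{v, c} \<in> ?m ` {0..<length es}" "{n, c} \<in> ?m ` {0..<length es}"
    using c(3,4) by blast+
  then obtain j k where "{v, c} = ?m j" "j \<in> {0..<length es}" "{n, c} = ?m k" "k \<in> {0..<length es}"
    by (elim imageE)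
  then have j: "{v, c} = ?m j" "j < length es" and k: "{n, c} = ?m k" "k < length es"
    by simp_all
  have "j \<notin> S"
  proof
    assume "j \<in> S"
    then have "n \<in> {v, c}" unfolding j(1) by simp
    then show False using v c(2) by simp
  qed
  then have ej: "es ! j = {v, c}" using j by simp
  have "k \<in> S"
  proof (rule ccontr)
    assume "k \<notin> S"
    then have "n \<in> es ! k" using k(1) by auto
    then show False using edge_less[OF wf k(2)] by blast
  qed
  then obtain u where u: "es ! k = {u, v}" "u \<noteq> v" "u < n"
    using incident_edgeE[OF wf] S by blast
  then have "?m k = {n, u}" using \<open>k \<in> S\<close> by auto
  with k(1) have "{n, c} = {n, u}" by (rule trans)
  then have "u = c" using c(2) by (auto simp: doubleton_eq_iff)
  then have "es ! k = es ! j" using u ej by auto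
  moreover have "distinct es" using wf by (simp add: wf_graph_def)
  ultimately have "k = j" using j k nth_eq_iff_index_eq by blast
  then show False using \<open>k \<in> S\<close> \<open>j \<notin> S\<close> by simp
qed

text \<open>The new vertex has a single neighbour.\<close>

lemma not_triangulated_leaf:
  assumes wf: "wf_graph (n, es)" and u: "u < n"
  shows "\<not> triangulated (Suc n, es @ [{u, n}])"
proof
  assume "triangulated (Suc n, es @ [{u, n}])"
  from this[unfolded triangulated_def, rule_format, of u n]
  obtain c where c: "c \<noteq> u" "c \<noteq> n" "{n, c} \<in> set (es @ [{u, n}])"
    by auto
  then have "{n, c} \<noteq> {u, n}" by (auto simp: doubleton_eq_iff)
  then have "{n, c} \<in> set es" using c(3) by simp
  then obtain a b where "{n, c} = {a, b}" "a < n" "b < n" by (rule wf_graph_edgeE[OF wf])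
  then show False by (auto simp: doubleton_eq_iff)
qed

lemma iso_weight_triangulated: "triangulated W \<Longrightarrow> \<not> triangulated G \<Longrightarrow> iso_weight W G = 0"
  using triangulated_iso iso_weight_zero unfolding isomorphic_def by blast

text \<open>Each graph occurring in the differential has weight zero by itself, so the sum over all
  subsets in \<open>eqv_ins_edge\<close> is used directly, before any cancellation of leaves or
  subdivisions.\<close>

lemma wcoeff_dgc:
  assumes W: "wf_graph W" "triangulated W" and c: "is_chain c"
  shows "wcoeff W (dgc c) = 0"
proof -
  have "wcoeff W (d_graph G) = 0" if G: "wf_graph G" for G
  proof -
    obtain n es where ne: "G = (n, es)" by (cases G)
    note wf = G[unfolded ne]
    have "wcoeff W (ins edge_graph (n, es)) =
        (\<Sum>v<n. \<Sum>S\<in>Pow (incident es v). iso_weight W (split_graph (n, es) v S))"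
      using wcoeff_eqv[OF W(1) eqv_ins_edge[OF wf]] by (simp add: wcoeff_sum wcoeff_ind[OF W(1)])
    also have "\<dots> = 0"
      using not_triangulated_split[OF wf] by (intro sum.neutral ballI iso_weight_triangulated[OF W(2)]) auto
    finally have "wcoeff W (ins edge_graph G) = 0" by (simp add: ne)
    moreover have "wcoeff W (ins G edge_graph) = 0"
      using not_triangulated_leaf[OF wf]
      by (simp add: ne ins_into_edge wcoeff_smult wcoeff_sum wcoeff_ind[OF W(1)] iso_weight_triangulated[OF W(2)])
    ultimately show ?thesis by (simp add: d_graph_def wcoeff_diff wcoeff_smult)
  qed
  moreover have "dgc c = (\<lambda>H. \<Sum>G\<in>supp c. c G * d_graph G H)"
    by (simp add: dgc_def d_graph_def)
  ultimately show ?thesis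
    using c by (simp add: wcoeff_sum wcoeff_smult is_chain_def)
qed

text \<open>The actions of \<open>p\<close> on \<open>A\<close> and on its complement are conjugate
  under \<open>f\<close>, hence have equal signs, and their product is 1.\<close>

lemma sign_commuting_involution:
  assumes S: "finite S" and p: "p permutes S" and f: "f permutes S" "\<And>i. f (f i) = i"
    and A: "A \<subseteq> S" "f ` A = S - A" "\<And>i. i \<in> A \<Longrightarrow> p i \<in> A"
    and comm: "\<And>i. i \<in> A \<Longrightarrow> p (f i) = f (p i)"
  shows "sign p = 1"
proof -
  \<comment> \<open>\<open>q\<close> is the action on \<open>A\<close>, extended by the identity;
    \<open>f \<circ> q \<circ> f\<close> is then the action on the complement.\<close>
  define q where "q i = (if i \<in> A then p i else i)" for i
  have "finite A" using A(1) S finite_subset by blast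
  have "inj_on p A" using permutes_inj[OF p] by (simp add: inj_on_def)
  then have "p ` A = A" using endo_inj_surj[OF \<open>finite A\<close>] A(3) by blast
  then have "bij_betw q A A"
    using \<open>inj_on p A\<close> by (auto simp: bij_betw_def q_def inj_on_def)
  then have "q permutes A" by (rule bij_imp_permutes) (simp add: q_def)
  then have q: "q permutes S" using A(1) by (rule permutes_subset)
  have "p i = (q \<circ> (f \<circ> q \<circ> f)) i" for i
  proof -
    consider "i \<in> A" | j where "j \<in> A" "i = f j" | "i \<notin> S" using A(2) by blast
    then show ?thesis
    proof cases
      case 1
      then have "f i \<notin> A" using A(2) by blast
      then show ?thesis using 1 by (simp add: q_def f(2))
    next
      case 2
      then have "f (p j) \<notin> A" using A(2,3) by blast
      then show ?thesis using 2 comm by (simp add: q_def f(2))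
    next
      case 3
      then have "f i = i" "i \<notin> A" using permutes_not_in[OF f(1)] A(1) by auto
      then show ?thesis using 3 permutes_not_in[OF p] by (simp add: q_def)
    qed
  qed
  then have "p = q \<circ> (f \<circ> q \<circ> f)" by (rule ext)
  moreover have "permutation q" "permutation f"
    using q f(1) S permutes_imp_permutation by blast+
  ultimately have "sign p = sign q * (sign f * sign q * sign f)"
    by (simp add: sign_compose permutation_compose)
  then show ?thesis by (cases q rule: sign_cases; cases f rule: sign_cases) simp_all
qed

section \<open>The heptagon wheel\<close>

definition adjacent :: "(nat \<times> nat) list \<Rightarrow> nat \<Rightarrow> nat \<Rightarrow> bool" where
  "adjacent ps x y \<longleftrightarrow> (x, y) \<in> set ps \<or> (y, x) \<in> set ps"

lemma edge_pair_graph: "{x, y} \<in> set (snd (pair_graph n ps)) \<longleftrightarrow> adjacent ps x y"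
  by (auto simp: pair_graph_def adjacent_def doubleton_eq_iff)

definition wheel :: "(nat \<times> nat) list" where
  "wheel = [(0,5), (0,6), (0,7), (1,2), (1,4), (1,7), (2,3), (2,7), (3,5), (3,7), (4,6), (4,7), (5,7), (6,7)]"

text \<open>The positions in \<open>wheel\<close> of the spoke at \<open>x\<close> and of the rim edge opposite to \<open>x\<close>.\<close>

definition spoke :: "nat list" where "spoke = [2, 5, 7, 9, 11, 12, 13]"
definition rim :: "nat list" where "rim = [3, 0, 1, 10, 8, 4, 6]"

text \<open>For rim vertices this is distance three in the 7-cycle, so each has two opposite
  vertices, the ends of its opposite rim edge. Only rim vertices \<open>z\<close> are tested, since
  the hub is a common neighbour of all of them. Phrased through adjacency, the relation is visibly
  preserved by automorphisms.\<close>

definition opposite :: "nat \<Rightarrow> nat \<Rightarrow> bool" where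
  "opposite x y \<longleftrightarrow> y < 7 \<and> y \<noteq> x \<and> \<not> adjacent wheel x y \<and>
     list_all (\<lambda>z. \<not> (adjacent wheel x z \<and> adjacent wheel z y)) [0..<7]"

text \<open>The table exchanges the positions \<open>spoke ! x\<close> and \<open>rim ! x\<close>
  for each rim vertex \<open>x\<close>.\<close>

definition swap_opposite :: "nat \<Rightarrow> nat" where
  "swap_opposite i = (if i < 14 then [5, 7, 3, 2, 12, 0, 13, 1, 11, 10, 9, 8, 4, 6] ! i else i)"

lemma heptagon_wheel_eq: "heptagon_wheel = pair_graph 8 wheel"
  by (simp add: heptagon_wheel_def wheel_def gr8_def dec_edge_def pair_graph_def)

lemma gamma7_scaled_Cons: "gamma7_scaled = (16, wheel) # tl gamma7_scaled"
  by (simp add: gamma7_scaled_def wheel_def)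

lemma wheel_valid: "valid_pairs 8 wheel"
  by code_simp

lemma length_wheel: "length wheel = 14"
  by code_simp

lemma wheel_triangulated_pairs:
  "list_all (\<lambda>(a, b). list_ex (\<lambda>c. c \<noteq> a \<and> c \<noteq> b \<and> adjacent wheel a c \<and> adjacent wheel b c) [0..<8]) wheel"
  by code_simp

lemma wheel_hub: "list_all (\<lambda>y. adjacent wheel 7 y) [0..<7]"
  by code_simp

text \<open>Makes vertex 7 the only vertex joined to all the others, hence fixed by every
  automorphism.\<close>

lemma wheel_no_second_hub:
  "list_all (\<lambda>z. list_ex (\<lambda>w. w \<noteq> z \<and> \<not> adjacent wheel z w) [0..<8]) [0..<7]"
  by code_simp

text \<open>A vertex joined to all the others is an isomorphism invariant that the 45 remaining
  terms lack. This separates them from the wheel without any search for isomorphisms.\<close>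

lemma no_hub:
  "list_all (\<lambda>(c, ps). list_all (\<lambda>z. list_ex (\<lambda>w. w \<noteq> z \<and> \<not> adjacent ps z w) [0..<8]) [0..<8])
    (tl gamma7_scaled)"
  by code_simp

text \<open>Certifies the tables: the ends of the edge at \<open>rim ! x\<close> are precisely the
  two vertices opposite to \<open>x\<close>.\<close>

lemma wheel_spoke_rim:
  "list_all (\<lambda>x. spoke ! x < 14 \<and> rim ! x < 14 \<and> wheel ! (spoke ! x) = (x, 7) \<and>
     swap_opposite (spoke ! x) = rim ! x \<and>
     (case wheel ! (rim ! x) of (a, b) \<Rightarrow> a < 7 \<and> b < 7 \<and>
       list_all (\<lambda>y. opposite x y \<longleftrightarrow> y = a \<or> y = b) [0..<7])) [0..<7]"
  by code_simp

lemma swap_opposite_code: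
  "list_all (\<lambda>i. swap_opposite i < 14 \<and> swap_opposite (swap_opposite i) = i \<and>
     (i \<in> set spoke \<longleftrightarrow> swap_opposite i \<notin> set spoke)) [0..<14]"
  by code_simp

lemma set_spoke: "set spoke = (\<lambda>x. spoke ! x) ` {0..<7}"
  by code_simp

lemma triangulated_wheel: "triangulated heptagon_wheel"
  unfolding triangulated_def heptagon_wheel_eq edge_pair_graph
proof (intro allI impI)
  have apex: "\<exists>c. c \<noteq> a \<and> c \<noteq> b \<and> adjacent wheel a c \<and> adjacent wheel b c"
    if "(a, b) \<in> set wheel" for a b
    using wheel_triangulated_pairs that unfolding list_all_iff list_ex_iff by blast
  fix a b assume "adjacent wheel a b"
  then show "\<exists>c. c \<noteq> a \<and> c \<noteq> b \<and> adjacent wheel a c \<and> adjacent wheel b c"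
    using apex[of a b] apex[of b a] unfolding adjacent_def by blast
qed

lemma wf_heptagon_wheel: "wf_graph heptagon_wheel"
  by (simp add: heptagon_wheel_eq wf_pair_graph wheel_valid)

text \<open>In a cycle of odd length every edge has an opposite vertex. Hence exchanging each rim edge
  with the spoke at its opposite vertex is an involution of the edges that commutes with all
  automorphisms.\<close>

lemma sign_wheel_automorphism:
  assumes "iso_sign heptagon_wheel heptagon_wheel s"
  shows "s = 1"
proof -
  define es where "es = snd (pair_graph 8 wheel)"
  have W: "heptagon_wheel = (8, es)"
    by (simp add: es_def heptagon_wheel_eq pair_graph_def)
  have len: "length es = 14"
    by (simp add: es_def pair_graph_def length_wheel)
  have es_nth: "es ! i = {fst (wheel ! i), snd (wheel ! i)}" if "i < 14" for i
    using that by (simp add: es_def pair_graph_def length_wheel case_prod_unfold)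
  have dist: "distinct es"
    using wf_heptagon_wheel by (simp add: W wf_graph_def)
  have es_inj: "i = j" if "es ! i = es ! j" "i < 14" "j < 14" for i j
    using nth_eq_iff_index_eq[OF dist] that len by simp
  have adj: "{x, y} \<in> set es \<longleftrightarrow> adjacent wheel x y" for x y
    unfolding es_def by (rule edge_pair_graph)
  obtain \<pi> p where \<pi>: "\<pi> permutes {0..<8}" and p: "p permutes {0..<14}"
    and e: "\<And>i. i < 14 \<Longrightarrow> es ! p i = \<pi> ` (es ! i)" and s: "s = sign p"
    using iso_signE[OF assms[unfolded W]] unfolding len by blast
  have p_less: "p i < 14 \<longleftrightarrow> i < 14" for i
    using permutes_in_image[OF p, of i] by simp
  have \<pi>_less: "\<pi> x < 8 \<longleftrightarrow> x < 8" for x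
    using permutes_in_image[OF \<pi>, of x] by simp
  have \<pi>_eq: "\<pi> x = \<pi> y \<longleftrightarrow> x = y" for x y
    using permutes_inj[OF \<pi>] by (simp add: inj_eq)
  have \<pi>_surj: "\<exists>x. y = \<pi> x" for y
    using permutes_surj[OF \<pi>] by (simp add: surj_def)
  have \<pi>_adj: "adjacent wheel (\<pi> x) (\<pi> y) \<longleftrightarrow> adjacent wheel x y" for x y
  proof -
    have "{\<pi> x, \<pi> y} \<in> set es \<longleftrightarrow> {x, y} \<in> set es"
    proof
      assume "{x, y} \<in> set es"
      then obtain i where "i < 14" "es ! i = {x, y}" using len by (auto simp: in_set_conv_nth)
      then have "es ! p i = {\<pi> x, \<pi> y}" "p i < length es" using e p_less len by auto
      then show "{\<pi> x, \<pi> y} \<in> set es" by (metis nth_mem)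
    next
      assume "{\<pi> x, \<pi> y} \<in> set es"
      then obtain j where j: "j < 14" "es ! j = {\<pi> x, \<pi> y}" using len by (auto simp: in_set_conv_nth)
      define i where "i = inv p j"
      have i: "p i = j" "i < 14"
        using j(1) p_less[of i] by (simp_all add: i_def permutes_inverses[OF p])
      then have "\<pi> ` (es ! i) = \<pi> ` {x, y}" using e[of i] j(2) by simp
      then have "es ! i = {x, y}" by (simp only: inj_image_eq_iff[OF permutes_inj[OF \<pi>]])
      then show "{x, y} \<in> set es" using i len nth_mem[of i es] by simp
    qed
    then show ?thesis by (simp add: adj)
  qed
  have hub: "\<pi> 7 = 7"
  proof (rule ccontr)
    assume "\<pi> 7 \<noteq> 7"
    then have "\<pi> 7 < 7" using \<pi>_less[of 7] by simp
    then obtain w where w: "w < 8" "w \<noteq> \<pi> 7" "\<not> adjacent wheel (\<pi> 7) w"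
      using wheel_no_second_hub[unfolded list_all_iff list_ex_iff, rule_format, of "\<pi> 7"] by auto
    obtain y where y: "w = \<pi> y" using \<pi>_surj by blast
    then have "y < 7" using w \<pi>_less[of y] \<pi>_eq[of y 7] by auto
    then show False using w(3) wheel_hub by (simp add: y \<pi>_adj list_all_iff)
  qed
  have \<pi>_rim: "\<pi> x < 7 \<longleftrightarrow> x < 7" for x
    using \<pi>_less[of x] \<pi>_eq[of x 7] hub by auto
  have \<pi>_opp: "opposite (\<pi> x) (\<pi> y) \<longleftrightarrow> opposite x y" for x y
  proof -
    have "(\<forall>z<7. \<not> (adjacent wheel (\<pi> x) z \<and> adjacent wheel z (\<pi> y))) \<longleftrightarrow>
        (\<forall>z<7. \<not> (adjacent wheel x z \<and> adjacent wheel z y))"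
      (is "(\<forall>z. ?P z) \<longleftrightarrow> _")
    proof -
      \<comment> \<open>The quantified rim vertex is reindexed along the surjection
        \<open>\<pi>\<close>, which preserves the rim.\<close>
      have "(\<forall>z. ?P z) \<longleftrightarrow> (\<forall>z. ?P (\<pi> z))" by (metis \<pi>_surj)
      then show ?thesis by (simp add: \<pi>_adj \<pi>_rim)
    qed
    then show ?thesis
      by (simp add: opposite_def \<pi>_rim \<pi>_eq \<pi>_adj list_all_iff Ball_def)
  qed
  have spoke_rim: "spoke ! x < 14" "rim ! x < 14" "es ! (spoke ! x) = {x, 7}"
    "swap_opposite (spoke ! x) = rim ! x" "es ! (rim ! x) = {y. opposite x y}" if "x < 7" for x
  proof -
    obtain a b where ab: "wheel ! (rim ! x) = (a, b)" by (cases "wheel ! (rim ! x)")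
    have *: "spoke ! x < 14" "rim ! x < 14" "wheel ! (spoke ! x) = (x, 7)"
      "swap_opposite (spoke ! x) = rim ! x" "a < 7" "b < 7" "\<And>y. y < 7 \<Longrightarrow> opposite x y \<longleftrightarrow> y = a \<or> y = b"
      using wheel_spoke_rim[unfolded list_all_iff, rule_format, of x] that ab by auto
    then show "spoke ! x < 14" "rim ! x < 14" "swap_opposite (spoke ! x) = rim ! x" by blast+
    show "es ! (spoke ! x) = {x, 7}" using *(1,3) by (simp add: es_nth)
    \<comment> \<open>The computation covers \<open>y\<close> below 7 only; beyond that
      \<open>opposite\<close> is false by definition, and \<open>a\<close> and \<open>b\<close> lie
      on the rim.\<close>
    have "opposite x y \<longleftrightarrow> y = a \<or> y = b" for y
      using *(5-7) by (cases "y < 7") (auto simp: opposite_def)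
    then show "es ! (rim ! x) = {y. opposite x y}" using *(2) ab by (auto simp: es_nth)
  qed
  have p_spoke: "p (spoke ! x) = spoke ! \<pi> x" and p_rim: "p (rim ! x) = rim ! \<pi> x" if x: "x < 7" for x
  proof -
    \<comment> \<open>Since the edge list is distinct, equal edges sit at equal positions; this
      turns the action on vertices into a formula for \<open>p\<close>.\<close>
    have "es ! p (spoke ! x) = es ! (spoke ! \<pi> x)"
      using x by (simp add: e spoke_rim \<pi>_rim hub)
    then show "p (spoke ! x) = spoke ! \<pi> x"
      by (rule es_inj) (use x in \<open>simp_all add: p_less spoke_rim \<pi>_rim\<close>)
    have "\<pi> ` {y. opposite x y} = {y. opposite (\<pi> x) y}"
    proof (intro equalityI subsetI)
      fix y assume y: "y \<in> {y. opposite (\<pi> x) y}"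
      obtain w where "y = \<pi> w" using \<pi>_surj by blast
      then show "y \<in> \<pi> ` {y. opposite x y}" using y by (simp add: \<pi>_opp)
    qed (auto simp: \<pi>_opp)
    then have "es ! p (rim ! x) = es ! (rim ! \<pi> x)"
      using x by (simp add: e spoke_rim \<pi>_rim)
    then show "p (rim ! x) = rim ! \<pi> x"
      by (rule es_inj) (use x in \<open>simp_all add: p_less spoke_rim \<pi>_rim\<close>)
  qed
  have invol: "swap_opposite i < 14" "swap_opposite (swap_opposite i) = i"
    "i \<in> set spoke \<longleftrightarrow> swap_opposite i \<notin> set spoke" if "i < 14" for i
    using swap_opposite_code[unfolded list_all_iff, rule_format, of i] that by simp_all
  have invol': "swap_opposite (swap_opposite i) = i" for i
    using invol(2)[of i] by (cases "i < 14") (simp_all add: swap_opposite_def)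
  have "sign p = 1"
  proof (rule sign_commuting_involution[where S = "{0..<14}" and A = "set spoke" and f = swap_opposite])
    have "bij_betw swap_opposite {0..<14} {0..<14}"
      by (rule bij_betw_byWitness[where f' = swap_opposite]) (auto simp: invol)
    then show "swap_opposite permutes {0..<14}"
      by (rule bij_imp_permutes) (simp add: swap_opposite_def)
    show spoke: "set spoke \<subseteq> {0..<14}" by (auto simp: set_spoke spoke_rim)
    show "swap_opposite ` set spoke = {0..<14} - set spoke"
    proof (intro equalityI subsetI)
      fix i assume "i \<in> swap_opposite ` set spoke"
      then obtain j where j: "i = swap_opposite j" "j \<in> set spoke" by blast
      then have "j < 14" using spoke by auto
      then show "i \<in> {0..<14} - set spoke" using j invol(1,3)[of j] by simp
    next
      fix i assume "i \<in> {0..<14} - set spoke"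
      then have "swap_opposite i \<in> set spoke" using invol(3)[of i] by auto
      then show "i \<in> swap_opposite ` set spoke"
        using invol' by (intro image_eqI[of i _ "swap_opposite i"]) auto
    qed
    fix i assume "i \<in> set spoke"
    then obtain x where x: "i = spoke ! x" "x < 7" by (auto simp: set_spoke)
    then show "p i \<in> set spoke" by (simp add: p_spoke set_spoke \<pi>_rim)
    show "p (swap_opposite i) = swap_opposite (p i)"
      using x by (simp add: spoke_rim p_spoke p_rim \<pi>_rim)
  qed (use p invol' in auto)
  then show ?thesis using s by simp
qed

text \<open>Evenness enters here: with an odd automorphism both signs would occur, the value would
  be 0 and the functional would not detect the wheel.\<close>

lemma iso_weight_wheel: "iso_weight heptagon_wheel heptagon_wheel = 1"
  using sign_wheel_automorphism[of "- 1"] iso_sign_refl[of heptagon_wheel]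
  by (auto simp: iso_weight_def)

text \<open>Under an isomorphism the preimage of the hub would be joined to all the other
  vertices.\<close>

lemma not_isomorphic_wheel:
  assumes "(c, ps) \<in> set (tl gamma7_scaled)"
  shows "\<not> isomorphic (pair_graph 8 ps) heptagon_wheel"
proof
  assume "isomorphic (pair_graph 8 ps) heptagon_wheel"
  then obtain s where "iso_sign (pair_graph 8 ps) (pair_graph 8 wheel) s"
    by (auto simp: isomorphic_def heptagon_wheel_eq)
  then obtain \<pi> where \<pi>: "\<pi> permutes {0..<fst (pair_graph 8 ps)}"
    and "fst (pair_graph 8 wheel) = fst (pair_graph 8 ps)"
    and e: "\<And>e. \<pi> ` e \<in> set (snd (pair_graph 8 wheel)) \<longleftrightarrow> e \<in> set (snd (pair_graph 8 ps))"
    by (rule iso_sign_edges) blast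
  have \<pi>: "\<pi> permutes {0..<8}" using \<pi> by (simp add: pair_graph_def)
  have adj: "adjacent wheel (\<pi> x) (\<pi> y) \<longleftrightarrow> adjacent ps x y" for x y
    using e[of "{x, y}"] by (simp add: edge_pair_graph)
  define z where "z = inv \<pi> 7"
  have z: "\<pi> z = 7" by (simp add: z_def permutes_inverses[OF \<pi>])
  then have "z < 8"
    using permutes_in_image[OF \<pi>, of z] by simp
  have "\<forall>z\<in>{0..<8}. \<exists>w\<in>{0..<8}. w \<noteq> z \<and> \<not> adjacent ps z w"
    using no_hub[unfolded list_all_iff list_ex_iff, THEN bspec, OF assms] by simp
  from bspec[OF this, of z] \<open>z < 8\<close>
  obtain w where w: "w < 8" "w \<noteq> z" "\<not> adjacent ps z w" by auto
  have "\<pi> w < 8" "\<pi> w \<noteq> 7"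
    using w permutes_in_image[OF \<pi>, of w] z injD[OF permutes_inj[OF \<pi>], of w z] by auto
  then have "adjacent wheel 7 (\<pi> w)" using wheel_hub by (simp add: list_all_iff)
  then show False using adj[of z w] z w(3) by simp
qed

lemma wcoeff_gamma7: "wcoeff heptagon_wheel gamma7 = 1"
proof -
  have wcoeff: "wcoeff heptagon_wheel (\<lambda>H. \<Sum>(c, G)\<leftarrow>ts. c * ind G H) =
      (\<Sum>(c, G)\<leftarrow>ts. c * iso_weight heptagon_wheel G)" for ts
    by (induction ts)
      (auto simp: wcoeff_zero wcoeff_add wcoeff_smult wcoeff_ind[OF wf_heptagon_wheel])
  have "wcoeff heptagon_wheel gamma7 =
      (\<Sum>(c, ps)\<leftarrow>gamma7_scaled. of_int c / 16 * iso_weight heptagon_wheel (pair_graph 8 ps))"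
    unfolding gamma7_eq wcoeff by (simp add: comp_def case_prod_unfold)
  also have "\<dots> = iso_weight heptagon_wheel (pair_graph 8 wheel) +
      (\<Sum>(c, ps)\<leftarrow>tl gamma7_scaled. of_int c / 16 * iso_weight heptagon_wheel (pair_graph 8 ps))"
    by (subst gamma7_scaled_Cons) simp
  also have "(\<Sum>(c, ps)\<leftarrow>tl gamma7_scaled. of_int c / 16 * iso_weight heptagon_wheel (pair_graph 8 ps)) =
      (\<Sum>(c, ps)\<leftarrow>tl gamma7_scaled. 0)"
    by (intro arg_cong[where f = sum_list] map_cong refl)
      (auto simp: iso_weight_zero[OF not_isomorphic_wheel])
  also have "\<dots> = 0" by (simp add: case_prod_unfold)
  finally show ?thesis
    by (simp add: iso_weight_wheel flip: heptagon_wheel_eq)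
qed

theorem theorem3p1:
  shows "dgc gamma7 \<in> rel
    \<and> \<not> (\<exists>\<beta>. is_conn_chain \<beta> \<and> (\<lambda>H. dgc \<beta> H - gamma7 H) \<in> rel)
    \<and> \<not> (\<exists>c. (\<lambda>H. gamma7 H - c H) \<in> rel \<and>
             (\<forall>G\<in>supp c. \<not> isomorphic G heptagon_wheel))"
proof (intro conjI notI)
  show "dgc gamma7 \<in> rel" by (rule dgc_gamma7)
next
  assume "\<exists>\<beta>. is_conn_chain \<beta> \<and> (\<lambda>H. dgc \<beta> H - gamma7 H) \<in> rel"
  then obtain \<beta> where "is_chain \<beta>" "(\<lambda>H. dgc \<beta> H - gamma7 H) \<in> rel"
    by (auto simp: is_conn_chain_def)
  then show False
    using wcoeff_rel[OF wf_heptagon_wheel] wcoeff_dgc[OF wf_heptagon_wheel triangulated_wheel]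
    by (fastforce simp: wcoeff_diff wcoeff_gamma7)
next
  assume "\<exists>c. (\<lambda>H. gamma7 H - c H) \<in> rel \<and> (\<forall>G\<in>supp c. \<not> isomorphic G heptagon_wheel)"
  then obtain c where c: "(\<lambda>H. gamma7 H - c H) \<in> rel" "\<forall>G\<in>supp c. \<not> isomorphic G heptagon_wheel"
    by blast
  \<comment> \<open>A chain without copies of the wheel has value 0, yet the value depends only on
    the class modulo \<open>rel\<close>, and on \<open>gamma7\<close> it is 1.\<close>
  have "wcoeff heptagon_wheel c = 0"
    unfolding wcoeff_def using c(2) by (intro sum.neutral) (auto simp: supp_def)
  then show False
    using wcoeff_rel[OF wf_heptagon_wheel c(1)] by (simp add: wcoeff_diff wcoeff_gamma7)
qed

end
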